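(* Let $a>0$ and let $\epsilon>0$ be sufficiently small. Consider the regularized system $$\dot x=1,\qquad \epsilon\dot v=-a\epsilon v-\sin\!\left(\pi x\left[1+\tfrac12\psi(v)\right]\right).$$ Then every trajectory $v(x)$ of this system tends, as $x\to+\infty$, to the $4$-periodic function $v_r$ defined below, i.e. $v(x)-v_r(x)\to0$ as $x\to+\infty$.
   Context: $\psi:\mathbb{R}\to\mathbb{R}$ is a transition function: $C^1$ on $\mathbb{R}$ and $C^2$ on $[-1,1]$, with $\psi(v)=\operatorname{sign}(v)$ for $|v|\ge1$, $\psi'(v)>0$ for $|v|<1$, and $\operatorname{sign}\psi''(v)=-\operatorname{sign}(v)$ at $|v|=1$. For $n\in\mathbb{N}$ let $x^-_{\epsilon,2n}=4n+\frac{2}{\pi}\arcsin(a\epsilon)$ (the fold point near $x=4n$ on $v=-1$, where $a\epsilon-\sin(\pi x/2)=0$). Let $v_-(x,x_0)$ be the solution of $\epsilon\dot v=-a\epsilon v-\sin(\pi x/2)$ with $v_-(x_0,x_0)=-1$, and let $x_{\epsilon,a}>0$ be such that $x^-_{\epsilon,2n}+x_{\epsilon,a}$ is the next $x>x^-_{\epsilon,2n}$ at which $v_-(x,x^-_{\epsilon,2n})=-1$ (independent of $n$ by periodicity). The function $v_r$ is defined by $v_r(x)=v_-(x,x^-_{\epsilon,2n})$ for $x\in[x^-_{\epsilon,2n},x^-_{\epsilon,2n}+x_{\epsilon,a}]$ and $v_r(x)=-1$ for $x\in(x^-_{\epsilon,2n}+x_{\epsilon,a},x^-_{\epsilon,2n+2})$,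 $n\in\mathbb{N}$. *)

theory Defs
  imports "HOL-Analysis.Analysis"
begin

definition transition_function :: "(real \<Rightarrow> real) \<Rightarrow> bool" where
  "transition_function \<psi> \<longleftrightarrow>
     (\<exists>\<psi>1 \<psi>2.
        (\<forall>v. (\<psi> has_real_derivative \<psi>1 v) (at v)) \<and> continuous_on UNIV \<psi>1 \<and>
        (\<forall>v\<in>{-1..1}. (\<psi>1 has_real_derivative \<psi>2 v) (at v within {-1..1})) \<and>
        continuous_on {-1..1} \<psi>2 \<and>
        (\<forall>v. \<bar>v\<bar> \<ge> 1 \<longrightarrow> \<psi> v = sgn v) \<and>
        (\<forall>v. \<bar>v\<bar> < 1 \<longrightarrow> \<psi>1 v > 0) \<and>
        (\<forall>v. \<bar>v\<bar> = 1 \<longrightarrow> sgn (\<psi>2 v) = - sgn v))"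

definition fold_pt :: "real \<Rightarrow> real \<Rightarrow> int \<Rightarrow> real" where
  "fold_pt a \<epsilon> n = 4 * of_int n + 2 / pi * arcsin (a * \<epsilon>)"

definition v_minus :: "real \<Rightarrow> real \<Rightarrow> real \<Rightarrow> real \<Rightarrow> real" where
  "v_minus a \<epsilon> x0 = (THE f. f x0 = -1 \<and>
      (\<forall>x. (f has_real_derivative ((- a * \<epsilon> * f x - sin (pi * x / 2)) / \<epsilon>)) (at x)))"

definition x_ret :: "real \<Rightarrow> real \<Rightarrow> real" where
  "x_ret a \<epsilon> = Inf {t. t > 0 \<and> v_minus a \<epsilon> (fold_pt a \<epsilon> 0) (fold_pt a \<epsilon> 0 + t) = -1}"

definition v_r :: "real \<Rightarrow> real \<Rightarrow> real \<Rightarrow> real" where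
  "v_r a \<epsilon> x =
     (let n = \<lfloor>(x - fold_pt a \<epsilon> 0) / 4\<rfloor> in
      if x \<le> fold_pt a \<epsilon> n + x_ret a \<epsilon> then v_minus a \<epsilon> (fold_pt a \<epsilon> n) x else -1)"

end

theory Submission
  imports Defs
begin

text \<open>
  Let \<open>U x = x (1 + \<psi> (v x) / 2)\<close> be the phase of the forcing, so that \<open>x / 2 \<le> U x \<le> 3 x / 2\<close>.  If \<open>x\<close> is
  large, \<open>|v| < 1\<close> and \<open>sin (\<pi> U) > a \<epsilon>\<close>, then \<open>v\<close> falls at a fixed rate while \<open>U' \<approx> x \<psi>'(v) v' / 2\<close> is
  very negative.  Hence the levels of \<open>U\<close> with \<open>sin (\<pi> U) > a \<epsilon>\<close> are barriers that a trajectory can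
  cross upwards for good only by leaving \<open>|v| < 1\<close>.  As \<open>U \<ge> x / 2\<close> tends to infinity, every
  trajectory eventually reaches \<open>v = -1\<close>: otherwise it would have \<open>v > 1\<close> at one point of each period of
  the upper field, hence \<open>v \<ge> 1\<close> forever, which damping forbids.  Once at the bottom, the barriers
  force \<open>v\<close> to stay below \<open>-1 + o(1)\<close> and to leave through \<open>v = -1\<close> within \<open>o(1)\<close> after each fold point.
  Below \<open>-1\<close> both \<open>v\<close> and \<open>v_r\<close> solve the same linear equation with contracting differences, so
  \<open>0 \<le> v - v_r \<le> o(1)\<close> on each period.  All of this works as soon as \<open>a \<epsilon> < 1\<close>.
\<close>

section \<open>Crossing times and growth bounds for functions of one variable\<close>

text \<open>Such times mark the start of an excursion above \<open>c\<close>. The sublevel set is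
  compact, so it has a greatest element, and the intermediate value theorem forces the value
  \<open>c\<close> there.\<close>

lemma last_hit:
  fixes f :: "real \<Rightarrow> real"
  assumes "continuous_on {p..q} f" "p \<le> q" "f p \<le> c" "c \<le> f q"
  obtains t where "p \<le> t" "t \<le> q" "f t = c" "\<And>s. t < s \<Longrightarrow> s \<le> q \<Longrightarrow> c < f s"
proof -
  let ?S = "{p..q} \<inter> f -` {..c}"
  have S: "closed ?S" "bounded ?S" "?S \<noteq> {}"
    using assms by (auto intro!: continuous_closed_preimage bounded_Int)
  then have "compact ?S" by (simp add: compact_eq_bounded_closed)
  then obtain t where t: "t \<in> ?S" "\<And>s. s \<in> ?S \<Longrightarrow> s \<le> t"
    using continuous_attains_sup[OF _ S(3) continuous_on_id] by blast
  have after: "c < f s" if "t < s" "s \<le> q" for s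
  proof (rule ccontr)
    assume "\<not> c < f s"
    then have "s \<in> ?S" using that t(1) by auto
    with t(2) that show False by fastforce
  qed
  have "\<exists>r\<ge>t. r \<le> q \<and> f r = c"
    using IVT'[of f t c q] t(1) assms continuous_on_subset[OF assms(1), of "{t..q}"] by auto
  then obtain r where r: "t \<le> r" "r \<le> q" "f r = c" by blast
  with t(2)[of r] t(1) have "r = t" by force
  with r after t(1) that show thesis by auto
qed

text \<open>Passing to \<open>- f (- s)\<close> reverses time and order, which turns last hits into
  first hits.\<close>

lemma first_hit:
  fixes f :: "real \<Rightarrow> real"
  assumes "continuous_on {p..q} f" "p \<le> q" "f p \<le> c" "c \<le> f q"
  obtains t where "p \<le> t" "t \<le> q" "f t = c" "\<And>s. p \<le> s \<Longrightarrow> s < t \<Longrightarrow> f s < c"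
proof -
  have "continuous_on {-q..-p} (\<lambda>s. - f (- s))"
    using assms(1) by (intro continuous_intros continuous_on_compose2[OF assms(1)]) auto
  then obtain t where t: "-q \<le> t" "t \<le> -p" "- f (- t) = - c"
      "\<And>s. t < s \<Longrightarrow> s \<le> -p \<Longrightarrow> - c < - f (- s)"
    using last_hit[of "-q" "-p" "\<lambda>s. - f (- s)" "-c"] assms by auto
  show thesis
    by (rule that[of "-t"]) (use t(1-3) t(4)[of "- s" for s] in force)+
qed

lemma deriv_le_imp_growth_le:
  fixes f :: "real \<Rightarrow> real"
  assumes "p \<le> q" "\<And>x. p \<le> x \<Longrightarrow> x \<le> q \<Longrightarrow> (f has_real_derivative f' x) (at x)"
    and "\<And>x. p < x \<Longrightarrow> x < q \<Longrightarrow> f' x \<le> C"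
  shows "f q \<le> f p + C * (q - p)"
proof (cases "p = q")
  case False
  with assms MVT2[of p q f f'] obtain z where "p < z" "z < q" "f q - f p = (q - p) * f' z"
    by (metis order_le_less)
  with assms(3)[of z] show ?thesis
    using mult_left_mono[of "f' z" C "q - p"] by (simp add: algebra_simps)
qed auto

lemma deriv_ge_imp_growth_ge:
  fixes f :: "real \<Rightarrow> real"
  assumes "p \<le> q" "\<And>x. p \<le> x \<Longrightarrow> x \<le> q \<Longrightarrow> (f has_real_derivative f' x) (at x)"
    and "\<And>x. p < x \<Longrightarrow> x < q \<Longrightarrow> C \<le> f' x"
  shows "f p + C * (q - p) \<le> f q"
proof -
  have "- f q \<le> - f p + - C * (q - p)"
    by (rule deriv_le_imp_growth_le[where f' = "\<lambda>x. - f' x"])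
      (use assms in \<open>auto intro: DERIV_minus\<close>)
  then show ?thesis by simp
qed

text \<open>Applied at a last crossing, this gives the sign of the vector field there and so
  confines the crossing to one part of the period.\<close>

lemma deriv_nonneg_if_above_right:
  fixes f :: "real \<Rightarrow> real"
  assumes "(f has_real_derivative D) (at t)" "t < q" "\<And>s. t < s \<Longrightarrow> s \<le> q \<Longrightarrow> f t < f s"
  shows "0 \<le> D"
proof (rule ccontr)
  assume "\<not> 0 \<le> D"
  then obtain d where d: "d > 0" "\<And>h. 0 < h \<Longrightarrow> h < d \<Longrightarrow> f (t + h) < f t"
    using DERIV_neg_dec_right[OF assms(1)] by auto
  define h where "h = min (d/2) (q - t)"
  have "0 < h" "h < d" "t + h \<le> q" using d(1) assms(2) by (auto simp: h_def)
  with d(2)[of h] assms(3)[of "t + h"] show False by auto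
qed

lemma sin_pi_add_even: "sin (pi * (2 * of_int n + z)) = sin (pi * z)"
proof -
  have "pi * (2 * of_int n + z) = pi * z + (2 * pi) * of_int n" by (simp add: algebra_simps)
  then show ?thesis by (simp only: sin_add sin_int_2pin cos_int_2pin mult_1_right mult_zero_right add_0_right)
qed

lemma cos_pi_add_even: "cos (pi * (2 * of_int n + z)) = cos (pi * z)"
proof -
  have "pi * (2 * of_int n + z) = pi * z + (2 * pi) * of_int n" by (simp add: algebra_simps)
  then show ?thesis by (simp only: cos_add sin_int_2pin cos_int_2pin mult_1_right mult_zero_right diff_0_right)
qed

section \<open>Fold points and the comparison solution \<open>v_minus\<close>\<close>

locale damped_forcing =
  fixes a \<epsilon> :: real
  assumes a_pos: "0 < a" and eps_pos: "0 < \<epsilon>" and a_eps: "a * \<epsilon> < 1"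
begin

text \<open>The difference of two solutions times \<open>exp (a * x)\<close> is constant, and the
  common initial value makes it zero. This is the uniqueness behind \<open>THE\<close>.\<close>

lemma v_minus_eqI:
  assumes "g p = -1"
    and "\<And>x. (g has_real_derivative (- a * g x - sin (pi * x / 2) / \<epsilon>)) (at x)"
  shows "v_minus a \<epsilon> p = g"
  unfolding v_minus_def
proof (rule the_equality)
  have *: "(- a * \<epsilon> * w - z) / \<epsilon> = - a * w - z / \<epsilon>" for w z
    using eps_pos by (simp add: field_simps)
  show "g p = -1 \<and> (\<forall>x. (g has_real_derivative ((- a * \<epsilon> * g x - sin (pi * x / 2)) / \<epsilon>)) (at x))"
    using assms by (simp only: *) simp
  fix h assume h: "h p = -1 \<and>
    (\<forall>x. (h has_real_derivative ((- a * \<epsilon> * h x - sin (pi * x / 2)) / \<epsilon>)) (at x))"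
  then have h': "(h has_real_derivative (- a * h x - sin (pi * x / 2) / \<epsilon>)) (at x)" for x
    by (simp only: *)
  have "((\<lambda>x. (h x - g x) * exp (a * x)) has_real_derivative 0) (at x)" for x
    by (rule derivative_eq_intros h' assms(2) refl)+ (simp add: algebra_simps)
  then have "(h x - g x) * exp (a * x) = (h p - g p) * exp (a * p)" for x
    using DERIV_isconst_all by blast
  then show "h = g" using h assms(1) by auto
qed

text \<open>Existence comes from an explicit formula: a sinusoidal particular solution plus a
  decaying exponential fitted to the initial value.\<close>

lemma v_minus_start: "v_minus a \<epsilon> p p = -1"
  and v_minus_deriv: "(v_minus a \<epsilon> p has_real_derivative
    (- a * v_minus a \<epsilon> p x - sin (pi * x / 2) / \<epsilon>)) (at x)"
proof -
  define \<omega> where "\<omega> = pi / 2"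
  define c where "c = - 1 / (\<epsilon> * (a\<^sup>2 + \<omega>\<^sup>2))"
  define part where "part x = c * (a * sin (\<omega> * x) - \<omega> * cos (\<omega> * x))" for x
  define g where "g x = part x + (-1 - part p) * exp (- a * (x - p))" for x
  have "a\<^sup>2 + \<omega>\<^sup>2 \<noteq> 0" using a_pos by (simp add: add_nonneg_eq_0_iff)
  then have c: "c * (a\<^sup>2 + \<omega>\<^sup>2) = - 1 / \<epsilon>" by (simp add: c_def)
  have part: "(part has_real_derivative (- a * part x - sin (\<omega> * x) / \<epsilon>)) (at x)" for x
  proof -
    have "(part has_real_derivative c * (a * (cos (\<omega> * x) * \<omega>) + \<omega> * (sin (\<omega> * x) * \<omega>))) (at x)"
      unfolding part_def[abs_def] by (auto intro!: derivative_eq_intros)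
    moreover have "c * (a * (cos (\<omega> * x) * \<omega>) + \<omega> * (sin (\<omega> * x) * \<omega>))
        = - a * part x + c * (a\<^sup>2 + \<omega>\<^sup>2) * sin (\<omega> * x)"
      by (simp add: part_def algebra_simps power2_eq_square)
    ultimately show ?thesis by (simp only: c) simp
  qed
  have "(g has_real_derivative (- a * g x - sin (pi * x / 2) / \<epsilon>)) (at x)" for x
    unfolding g_def[abs_def]
    by (rule derivative_eq_intros part refl)+ (simp add: algebra_simps \<omega>_def)
  moreover have "g p = -1" by (simp add: g_def)
  ultimately show "v_minus a \<epsilon> p p = -1"
    "(v_minus a \<epsilon> p has_real_derivative (- a * v_minus a \<epsilon> p x - sin (pi * x / 2) / \<epsilon>)) (at x)"
    using v_minus_eqI[of g p] by simp_all
qed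

definition fold0 :: real where
  "fold0 = 2 / pi * arcsin (a * \<epsilon>)"

lemma fold0_bounds: "0 < fold0" "fold0 < 1"
proof -
  have "arcsin 0 < arcsin (a * \<epsilon>)" "arcsin (a * \<epsilon>) < arcsin 1"
    using mult_pos_pos[OF a_pos eps_pos] a_eps by (intro arcsin_less_arcsin; linarith)+
  then show "0 < fold0" "fold0 < 1" by (simp_all add: fold0_def field_simps)
qed

lemma fold_pt_eq: "fold_pt a \<epsilon> n = 4 * of_int n + fold0"
  by (simp add: fold_pt_def fold0_def)

lemma sin_fold0: "sin (pi * fold0 / 2) = a * \<epsilon>"
proof -
  have "0 < a * \<epsilon>" using a_pos eps_pos by simp
  then show ?thesis using a_eps by (simp add: fold0_def)
qed

lemma sin_shift: "sin (pi * x / 2) = sin (pi * (x - 4 * of_int n) / 2)"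
proof -
  have "pi * x / 2 = pi * (2 * of_int n + (x - 4 * of_int n) / 2)" by (simp add: field_simps)
  then have "sin (pi * x / 2) = sin (pi * ((x - 4 * of_int n) / 2))"
    by (simp only: sin_pi_add_even)
  then show ?thesis by simp
qed

lemma sin_fold: "sin (pi * fold_pt a \<epsilon> n / 2) = a * \<epsilon>"
  using sin_shift[of "fold_pt a \<epsilon> n" n] sin_fold0 by (simp add: fold_pt_eq)

text \<open>On \<open>v = -1\<close> the field is \<open>a - sin (pi * x / 2) / \<epsilon>\<close>,
  so this lemma and \<open>sin_lt\<close> split a period into the part where it points down and the
  part where it points up. The sum-to-product formula reduces both to the signs of two
  factors.\<close>

lemma sin_gt:
  assumes "fold_pt a \<epsilon> n < x" "x < 4 * of_int n + 2 - fold0"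
  shows "a * \<epsilon> < sin (pi * x / 2)"
proof -
  define z where "z = x - 4 * of_int n"
  have z: "fold0 < z" "z < 2 - fold0" using assms by (auto simp: z_def fold_pt_eq)
  have "(pi * z / 2 - pi * fold0 / 2) / 2 = pi * ((z - fold0) / 4)"
    "(pi * z / 2 + pi * fold0 / 2) / 2 = pi * ((z + fold0) / 4)"
    by (simp_all add: field_simps)
  then have "sin (pi * z / 2) - sin (pi * fold0 / 2)
      = 2 * sin (pi * ((z - fold0) / 4)) * cos (pi * ((z + fold0) / 4))"
    by (simp only: sin_diff_sin)
  moreover have "0 < sin (pi * ((z - fold0) / 4))"
  proof (rule sin_gt_zero)
    show "pi * ((z - fold0) / 4) < pi"
      using mult_strict_left_mono[of "(z - fold0) / 4" 1 pi] z fold0_bounds by simp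
  qed (use z in simp)
  moreover have "0 < cos (pi * ((z + fold0) / 4))"
  proof (rule cos_gt_zero)
    show "pi * ((z + fold0) / 4) < pi / 2"
      using mult_strict_left_mono[of "(z + fold0) / 4" "1/2" pi] z by simp
  qed (use z fold0_bounds in simp)
  ultimately have "0 < sin (pi * z / 2) - sin (pi * fold0 / 2)" by simp
  then show ?thesis
    using sin_shift[of x n] sin_fold0 by (simp add: z_def)
qed

lemma sin_lt:
  assumes "4 * of_int n + 2 - fold0 < x" "x < fold_pt a \<epsilon> n + 4"
  shows "sin (pi * x / 2) < a * \<epsilon>"
proof -
  define z where "z = x - 4 * of_int n"
  have z: "2 - fold0 < z" "z < 4 + fold0" using assms by (auto simp: z_def fold_pt_eq)
  have "(pi * z / 2 - pi * fold0 / 2) / 2 = pi * ((z - fold0) / 4)"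
    "(pi * z / 2 + pi * fold0 / 2) / 2 = pi * ((z + fold0) / 4)"
    by (simp_all add: field_simps)
  then have "sin (pi * z / 2) - sin (pi * fold0 / 2)
      = 2 * sin (pi * ((z - fold0) / 4)) * cos (pi * ((z + fold0) / 4))"
    by (simp only: sin_diff_sin)
  moreover have "0 < sin (pi * ((z - fold0) / 4))"
  proof (rule sin_gt_zero)
    show "pi * ((z - fold0) / 4) < pi"
      using mult_strict_left_mono[of "(z - fold0) / 4" 1 pi] z fold0_bounds by simp
  qed (use z fold0_bounds in simp)
  moreover have "0 < cos (pi - pi * ((z + fold0) / 4))"
  proof (rule cos_gt_zero_pi)
    have "pi * ((z + fold0) / 4) < pi * (3/2)" "pi * (1/2) < pi * ((z + fold0) / 4)"
      using z fold0_bounds by (intro mult_strict_left_mono; simp)+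
    then show "- (pi / 2) < pi - pi * ((z + fold0) / 4)" "pi - pi * ((z + fold0) / 4) < pi / 2"
      by linarith+
  qed
  then have "cos (pi * ((z + fold0) / 4)) < 0" by simp
  ultimately have "sin (pi * z / 2) - sin (pi * fold0 / 2) < 0"
    by (simp add: mult_pos_neg)
  then show ?thesis
    using sin_shift[of x n] sin_fold0 by (simp add: z_def)
qed

text \<open>The forcing has period 4, so a translated solution solves the same problem and
  uniqueness applies. This reduces every period to \<open>n = 0\<close>.\<close>

lemma v_minus_shift: "v_minus a \<epsilon> (fold_pt a \<epsilon> n) x = v_minus a \<epsilon> (fold_pt a \<epsilon> 0) (x - 4 * of_int n)"
proof -
  have "v_minus a \<epsilon> (fold_pt a \<epsilon> n) = (\<lambda>x. v_minus a \<epsilon> (fold_pt a \<epsilon> 0) (x - 4 * of_int n))"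
  proof (rule v_minus_eqI)
    fix x
    show "((\<lambda>x. v_minus a \<epsilon> (fold_pt a \<epsilon> 0) (x - 4 * of_int n)) has_real_derivative
      - a * v_minus a \<epsilon> (fold_pt a \<epsilon> 0) (x - 4 * of_int n) - sin (pi * x / 2) / \<epsilon>) (at x)"
      using DERIV_shift[of "v_minus a \<epsilon> (fold_pt a \<epsilon> 0)" _ x "- 4 * of_int n"]
        v_minus_deriv[of "fold_pt a \<epsilon> 0" "x - 4 * of_int n"] sin_shift[of x n]
      by (simp del: minus_mult_left)
  qed (use v_minus_start in \<open>simp add: fold_pt_eq\<close>)
  then show ?thesis by simp
qed

text \<open>\<open>K x = (v_minus x + 1) exp (a x)\<close> decreases while \<open>sin (\<pi> x / 2) > a \<epsilon>\<close> and increases on the rest of the period, so it has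
  exactly one zero after the fold point.\<close>

lemma x_ret_first_return:
  shows "2 - 2 * fold0 < x_ret a \<epsilon>" "x_ret a \<epsilon> < 4"
    and "\<And>x. fold0 < x \<Longrightarrow> x < fold0 + x_ret a \<epsilon> \<Longrightarrow> v_minus a \<epsilon> fold0 x < -1"
    and "v_minus a \<epsilon> fold0 (fold0 + x_ret a \<epsilon>) = -1"
    and "\<And>x. fold0 + x_ret a \<epsilon> < x \<Longrightarrow> x \<le> fold0 + 4 \<Longrightarrow> -1 < v_minus a \<epsilon> fold0 x"
proof -
  define y where "y = v_minus a \<epsilon> fold0"
  define K where "K x = (y x + 1) * exp (a * x)" for x
  \<comment> \<open>The weight \<open>exp (a * x)\<close> absorbs the damping, so only the sign of
    \<open>a - sin (pi * x / 2) / \<epsilon>\<close> matters.\<close>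
  define K' where "K' x = (a - sin (pi * x / 2) / \<epsilon>) * exp (a * x)" for x
  have y': "(y has_real_derivative (- a * y x - sin (pi * x / 2) / \<epsilon>)) (at x)" for x
    unfolding y_def by (rule v_minus_deriv)
  have yf: "y fold0 = -1" by (simp add: y_def v_minus_start)
  have K': "(K has_real_derivative K' x) (at x)" for x
    unfolding K_def[abs_def] K'_def
    by (rule derivative_eq_intros y' refl)+ (simp add: algebra_simps)
  have sign: "K x < 0 \<longleftrightarrow> y x < -1" "K x = 0 \<longleftrightarrow> y x = -1" "0 < K x \<longleftrightarrow> -1 < y x" for x
    by (auto simp: K_def mult_less_0_iff zero_less_mult_iff)
  have contK: "continuous_on {p..q} K" for p q
    by (rule DERIV_atLeastAtMost_imp_continuous_on) (use K' in blast)
  have K_dec: "K q < K p" if "fold0 \<le> p" "p < q" "q \<le> 2 - fold0" for p q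
  proof (rule DERIV_neg_imp_decreasing_open[OF that(2) _ contK])
    fix x assume "p < x" "x < q"
    then have "a * \<epsilon> < sin (pi * x / 2)" using sin_gt[of 0 x] that by (simp add: fold_pt_eq)
    then have "a < sin (pi * x / 2) / \<epsilon>" using eps_pos by (simp add: pos_less_divide_eq)
    then show "\<exists>D. (K has_real_derivative D) (at x) \<and> D < 0"
      using K' by (auto simp: K'_def mult_less_0_iff intro!: exI[of _ "K' x"])
  qed
  have K_inc: "K p < K q" if "2 - fold0 \<le> p" "p < q" "q \<le> fold0 + 4" for p q
  proof (rule DERIV_pos_imp_increasing_open[OF that(2) _ contK])
    fix x assume "p < x" "x < q"
    then have "sin (pi * x / 2) < a * \<epsilon>" using sin_lt[of 0 x] that by (simp add: fold_pt_eq)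
    then have "sin (pi * x / 2) / \<epsilon> < a" using eps_pos by (simp add: pos_divide_less_eq)
    then show "\<exists>D. (K has_real_derivative D) (at x) \<and> 0 < D"
      using K' by (auto simp: K'_def intro!: exI[of _ "K' x"])
  qed
  have Kf: "K fold0 = 0" using yf sign by simp
  \<comment> \<open>If \<open>y\<close> stayed at or below -1 for a full period, damping would raise
    it by at least \<open>4 * a\<close>, while the forcing integrates to zero.\<close>
  have "\<exists>x. fold0 \<le> x \<and> x \<le> fold0 + 4 \<and> 0 < K x"
  proof (rule ccontr)
    assume "\<not> ?thesis"
    then have low: "y x \<le> -1" if "fold0 \<le> x" "x \<le> fold0 + 4" for x
      using that sign(3)[of x] by force
    have "(y fold0 - 2 / (pi * \<epsilon>) * cos (pi * fold0 / 2)) + a * (fold0 + 4 - fold0)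
        \<le> y (fold0 + 4) - 2 / (pi * \<epsilon>) * cos (pi * (fold0 + 4) / 2)"
    proof (rule deriv_ge_imp_growth_ge)
      fix x assume x: "fold0 \<le> x" "x \<le> fold0 + 4"
      show "((\<lambda>x. y x - 2 / (pi * \<epsilon>) * cos (pi * x / 2)) has_real_derivative - a * y x) (at x)"
        using eps_pos by (auto intro!: derivative_eq_intros y' simp: field_simps)
    next
      fix x assume "fold0 < x" "x < fold0 + 4"
      then show "a \<le> - a * y x" using low[of x] a_pos mult_left_mono[of "y x" "-1" a] by auto
    qed simp
    moreover have "cos (pi * (fold0 + 4) / 2) = cos (pi * fold0 / 2)"
    proof -
      have "pi * (fold0 + 4) / 2 = pi * (2 * of_int 1 + fold0 / 2)" by (simp add: field_simps)
      then show ?thesis by (simp only: cos_pi_add_even) simp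
    qed
    ultimately show False using low[of "fold0 + 4"] yf a_pos by simp
  qed
  then obtain x1 where x1: "fold0 \<le> x1" "x1 \<le> fold0 + 4" "0 < K x1" by blast
  have x1': "2 - fold0 < x1"
  proof (rule ccontr)
    assume "\<not> ?thesis"
    with x1 K_dec[of fold0 x1] Kf show False by (cases "x1 = fold0") auto
  qed
  have "K (2 - fold0) < 0" using K_dec[of fold0 "2 - fold0"] Kf fold0_bounds by simp
  then obtain R where R: "2 - fold0 \<le> R" "R \<le> x1" "K R = 0"
    using IVT'[of K "2 - fold0" 0 x1] x1 x1' contK by auto
  have R': "2 - fold0 < R" "R < fold0 + 4"
    using R x1 \<open>K (2 - fold0) < 0\<close> by (cases "R = 2 - fold0"; cases "R = x1"; force)+
  have before: "K x < 0" if "fold0 < x" "x < R" for x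
  proof (cases "x \<le> 2 - fold0")
    case True then show ?thesis using K_dec[of fold0 x] Kf that by simp
  next
    case False then show ?thesis using K_inc[of x R] R R' that by simp
  qed
  have after: "0 < K x" if "R < x" "x \<le> fold0 + 4" for x
    using K_inc[of R x] R R' that by simp
  have "x_ret a \<epsilon> = R - fold0"
    unfolding x_ret_def
  proof (rule cInf_eq_minimum)
    show "R - fold0 \<in> {t. 0 < t \<and> v_minus a \<epsilon> (fold_pt a \<epsilon> 0) (fold_pt a \<epsilon> 0 + t) = - 1}"
      using R' R fold0_bounds sign(2)[of R] by (simp add: fold_pt_eq y_def)
    fix t assume "t \<in> {t. 0 < t \<and> v_minus a \<epsilon> (fold_pt a \<epsilon> 0) (fold_pt a \<epsilon> 0 + t) = - 1}"
    then have "0 < t" "K (fold0 + t) = 0" using sign(2)[of "fold0 + t"] by (simp_all add: fold_pt_eq y_def)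
    then show "R - fold0 \<le> t" using before[of "fold0 + t"] by force
  qed
  then have RR: "fold0 + x_ret a \<epsilon> = R" by simp
  show "2 - 2 * fold0 < x_ret a \<epsilon>" "x_ret a \<epsilon> < 4" using RR R' by linarith+
  show "v_minus a \<epsilon> fold0 (fold0 + x_ret a \<epsilon>) = -1" using RR R sign by (simp add: y_def)
  show "\<And>x. fold0 < x \<Longrightarrow> x < fold0 + x_ret a \<epsilon> \<Longrightarrow> v_minus a \<epsilon> fold0 x < -1"
    using before sign(1) RR by (simp add: y_def)
  show "\<And>x. fold0 + x_ret a \<epsilon> < x \<Longrightarrow> x \<le> fold0 + 4 \<Longrightarrow> -1 < v_minus a \<epsilon> fold0 x"
    using after sign(3) RR by (simp add: y_def)
qed

lemma v_minus_fold_low: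
  assumes "fold_pt a \<epsilon> n \<le> x" "x \<le> fold_pt a \<epsilon> n + x_ret a \<epsilon>"
  shows "v_minus a \<epsilon> (fold_pt a \<epsilon> n) x \<le> -1"
proof -
  define z where "z = x - 4 * of_int n"
  have "z = fold0 \<or> z = fold0 + x_ret a \<epsilon> \<or> fold0 < z \<and> z < fold0 + x_ret a \<epsilon>"
    using assms by (auto simp: z_def fold_pt_eq)
  then have "v_minus a \<epsilon> fold0 z \<le> -1"
    using x_ret_first_return(3)[of z] x_ret_first_return(4) v_minus_start[of fold0] by (elim disjE) simp_all
  then show ?thesis using v_minus_shift[of n x] by (simp add: fold_pt_eq z_def)
qed

lemma v_minus_fold_return:
  assumes "fold_pt a \<epsilon> n + x_ret a \<epsilon> \<le> x" "x \<le> fold_pt a \<epsilon> n + 4"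
  shows "-1 \<le> v_minus a \<epsilon> (fold_pt a \<epsilon> n) x"
proof -
  define z where "z = x - 4 * of_int n"
  have "z = fold0 + x_ret a \<epsilon> \<or> fold0 + x_ret a \<epsilon> < z \<and> z \<le> fold0 + 4"
    using assms by (auto simp: z_def fold_pt_eq)
  then have "-1 \<le> v_minus a \<epsilon> fold0 z"
    using x_ret_first_return(5)[of z] x_ret_first_return(4) by (elim disjE) simp_all
  then show ?thesis using v_minus_shift[of n x] by (simp add: fold_pt_eq z_def)
qed

end

section \<open>The trajectory and the phase of its forcing\<close>

text \<open>Only the limit at infinity is at stake, so the start may be moved right: then the bounds
  on \<open>U\<close> hold and all derivatives are two-sided.\<close>

locale regularized_trajectory = damped_forcing a \<epsilon>
  for a \<epsilon> :: real +
  fixes \<psi> \<psi>1 v :: "real \<Rightarrow> real" and x0 :: real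
  assumes \<psi>_deriv: "\<And>w. (\<psi> has_real_derivative \<psi>1 w) (at w)"
    and \<psi>1_cont: "continuous_on UNIV \<psi>1"
    and \<psi>_low: "\<And>w. w \<le> -1 \<Longrightarrow> \<psi> w = -1"
    and \<psi>_high: "\<And>w. 1 \<le> w \<Longrightarrow> \<psi> w = 1"
    and \<psi>1_pos: "\<And>w. \<bar>w\<bar> < 1 \<Longrightarrow> 0 < \<psi>1 w"
    and x0_nonneg: "0 \<le> x0"
    and v_ode: "\<And>x. x0 < x \<Longrightarrow>
      (v has_real_derivative (- a * v x - sin (pi * (x * (1 + \<psi> (v x) / 2))) / \<epsilon>)) (at x)"
begin

definition U :: "real \<Rightarrow> real" where
  "U x = x * (1 + \<psi> (v x) / 2)"

definition v' :: "real \<Rightarrow> real" where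
  "v' x = - a * v x - sin (pi * U x) / \<epsilon>"

lemma v_deriv: "x0 < x \<Longrightarrow> (v has_real_derivative v' x) (at x)"
  using v_ode[of x] by (simp add: U_def v'_def)

lemma U_deriv:
  assumes "x0 < x"
  shows "(U has_real_derivative (1 + \<psi> (v x) / 2 + x * \<psi>1 (v x) * v' x / 2)) (at x)"
proof -
  have "((\<lambda>x. \<psi> (v x)) has_real_derivative \<psi>1 (v x) * v' x) (at x)"
    using DERIV_chain2[OF \<psi>_deriv v_deriv[OF assms]] .
  then have "((\<lambda>x. x * (1 + \<psi> (v x) / 2)) has_real_derivative
      (1 + \<psi> (v x) / 2 + x * \<psi>1 (v x) * v' x / 2)) (at x)"
    by (auto intro!: derivative_eq_intros)
  then show ?thesis by (simp add: U_def[abs_def])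
qed

lemma v_cont: "x0 < p \<Longrightarrow> continuous_on {p..q} v"
  by (rule DERIV_atLeastAtMost_imp_continuous_on) (meson v_deriv less_le_trans)

lemma U_cont: "x0 < p \<Longrightarrow> continuous_on {p..q} U"
  by (rule DERIV_atLeastAtMost_imp_continuous_on) (meson U_deriv less_le_trans)

lemma \<psi>_strict_mono:
  assumes "-1 \<le> s" "s < t" "t \<le> 1"
  shows "\<psi> s < \<psi> t"
proof -
  obtain z where "s < z" "z < t" "\<psi> t - \<psi> s = (t - s) * \<psi>1 z"
    using MVT2[OF assms(2) \<psi>_deriv] by blast
  moreover have "0 < (t - s) * \<psi>1 z"
    using \<psi>1_pos[of z] assms calculation by auto
  ultimately show ?thesis by linarith
qed

lemma \<psi>_mono: "s \<le> t \<Longrightarrow> \<psi> s \<le> \<psi> t"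
proof -
  have *: "-1 \<le> \<psi> w" "\<psi> w \<le> 1" for w
    using \<psi>_strict_mono[of "-1" w] \<psi>_strict_mono[of w 1] \<psi>_low[of w] \<psi>_high[of w] \<psi>_low[of "-1"] \<psi>_high[of 1]
    by (cases "w \<le> -1"; cases "1 \<le> w"; force)+
  show ?thesis if "s \<le> t"
    using that *[of s] *[of t] \<psi>_strict_mono[of s t] \<psi>_low[of s] \<psi>_high[of t]
    by (cases "s \<le> -1"; cases "1 \<le> t"; cases "s = t"; force)
qed

lemma \<psi>_bounds: "-1 \<le> \<psi> w" "\<psi> w \<le> 1"
  using \<psi>_mono[of "min w (-1)" w] \<psi>_mono[of w "max w 1"] \<psi>_low[of "min w (-1)"] \<psi>_high[of "max w 1"]
  by auto

lemma U_ge: "0 \<le> x \<Longrightarrow> x / 2 \<le> U x" and U_le: "0 \<le> x \<Longrightarrow> U x \<le> 3 * x / 2"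
  using \<psi>_bounds[of "v x"] mult_left_mono[of "1/2" "1 + \<psi> (v x) / 2" x]
    mult_left_mono[of "1 + \<psi> (v x) / 2" "3/2" x] by (auto simp: U_def)

lemma U_low: "v x \<le> -1 \<Longrightarrow> U x = x / 2" and U_high: "1 \<le> v x \<Longrightarrow> U x = 3 * x / 2"
  by (simp_all add: U_def \<psi>_low \<psi>_high)

section \<open>Barriers for the phase\<close>

text \<open>Quantitative form of the barrier. One \<open>T\<close> serves all \<open>n\<close>
  because the forcing depends on \<open>U\<close> only modulo 2.\<close>

lemma drop:
  assumes \<phi>: "a * \<epsilon> < sin (pi * \<phi>)" and "0 < h"
  shows "\<exists>T>x0. \<forall>t\<ge>T. \<forall>n::int. U t = 2 * of_int n + \<phi> \<longrightarrow> v t \<le> 1 \<longrightarrow>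
     (\<exists>s\<in>{t..t+h}. v s \<le> -1 \<or> U s < 2 * of_int n + \<phi>)"
proof -
  \<comment> \<open>With \<open>q\<close> strictly between the two values, \<open>v\<close> falls at
    rate at least \<open>\<sigma>\<close> while \<open>v > -1\<close> and \<open>U\<close> lies in a
    strip of height \<open>\<delta>\<close> above the level.\<close>
  define q where "q = (sin (pi * \<phi>) + a * \<epsilon>) / 2"
  define \<sigma> where "\<sigma> = (q - a * \<epsilon>) / \<epsilon>"
  have q: "a * \<epsilon> < q" "q < sin (pi * \<phi>)" using \<phi> by (auto simp: q_def mult.commute)
  then have \<sigma>: "0 < \<sigma>" using eps_pos by (simp add: \<sigma>_def)
  have "((\<lambda>z. sin (pi * z)) \<longlongrightarrow> sin (pi * \<phi>)) (at \<phi>)"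
    by (intro tendsto_intros)
  then have "eventually (\<lambda>z. q < sin (pi * z)) (at \<phi>)"
    using q(2) by (rule order_tendstoD)
  then obtain d where d: "0 < d" "\<And>z. z \<noteq> \<phi> \<Longrightarrow> dist z \<phi> < d \<Longrightarrow> q < sin (pi * z)"
    by (auto simp: eventually_at)
  define \<delta> where "\<delta> = d / 2"
  have \<delta>: "0 < \<delta>" "q < sin (pi * z)" if "\<phi> \<le> z" "z \<le> \<phi> + \<delta>" for z
    using d(1) d(2)[of z] that q(2) by (cases "z = \<phi>"; auto simp: \<delta>_def dist_real_def)+
  have \<delta>_pos: "0 < \<delta>" using d by (simp add: \<delta>_def)
  \<comment> \<open>The time window is so short that \<open>U\<close>, growing at rate at most 3/2,
    cannot climb out of the strip.\<close>
  define k where "k = min h (\<delta> / 2)"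
  have k: "0 < k" "k \<le> h" "3/2 * k < \<delta>" using assms(2) \<delta>_pos by (auto simp: k_def)
  let ?I = "{-1 + \<sigma> * k / 3 .. 1 - \<sigma> * k / 3}"
  have "\<exists>\<mu>>0. \<forall>w\<in>?I. \<mu> \<le> \<psi>1 w"
  \<comment> \<open>On an empty interval any positive \<open>\<mu>\<close> will do; otherwise
    compactness gives a positive minimum.\<close>
  proof (cases "?I = {}")
    case False
    then obtain w0 where w0: "w0 \<in> ?I" "\<And>w. w \<in> ?I \<Longrightarrow> \<psi>1 w0 \<le> \<psi>1 w"
      using continuous_attains_inf[of ?I \<psi>1] \<psi>1_cont continuous_on_subset by blast
    moreover have "0 < \<sigma> * k" using \<sigma> k by simp
    ultimately have "0 < \<psi>1 w0" by (intro \<psi>1_pos) (auto simp: abs_less_iff)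
    with w0 show ?thesis by blast
  qed (auto intro: exI[of _ 1])
  then obtain \<mu> where \<mu>: "0 < \<mu>" "\<And>w. w \<in> ?I \<Longrightarrow> \<mu> \<le> \<psi>1 w" by blast
  \<comment> \<open>For \<open>x\<close> beyond \<open>7 / (\<mu> * \<sigma>)\<close> the slope of
    \<open>U\<close> in the middle third is at most \<open>3/2 - 7/2 = -2\<close>, a loss of
    \<open>2 * k / 3\<close> against a gain of at most \<open>k / 2\<close> in the first
    third.\<close>
  define T where "T = max (x0 + 1) (7 / (\<mu> * \<sigma>))"
  show ?thesis
  proof (intro exI[of _ T] conjI allI impI)
    show "x0 < T" by (simp add: T_def)
    fix t n assume t: "T \<le> t" "U t = 2 * of_int n + \<phi>" "v t \<le> 1"
    have tx: "x0 < t" "0 < t" "7 / (\<mu> * \<sigma>) \<le> t" using t(1) x0_nonneg by (auto simp: T_def)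
    let ?L = "2 * of_int n + \<phi>"
    show "\<exists>s\<in>{t..t+h}. v s \<le> -1 \<or> U s < ?L"
    proof (rule ccontr)
      assume "\<not> ?thesis"
      then have stay: "-1 < v s" "?L \<le> U s" if "t \<le> s" "s \<le> t + k" for s
        using that k by force+
      have v'_le: "v' s \<le> - \<sigma>" if "t \<le> s" "s \<le> t + k" "U s \<le> ?L + \<delta>" for s
      proof -
        have "q < sin (pi * (U s - 2 * of_int n))"
          using \<delta>(2)[of "U s - 2 * of_int n"] stay(2)[of s] that by auto
        then have "q < sin (pi * U s)"
          using sin_pi_add_even[of n "U s - 2 * of_int n"] by simp
        then have "q / \<epsilon> \<le> sin (pi * U s) / \<epsilon>" using eps_pos by (simp add: divide_right_mono)
        moreover have "- a * v s \<le> a" using stay(1)[of s] that a_pos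
          mult_left_mono[of "-1" "v s" a] by auto
        ultimately show ?thesis using eps_pos by (simp add: \<sigma>_def v'_def diff_divide_distrib)
      qed
      have v_dec: "v q \<le> v p - \<sigma> * (q - p)"
        if "t \<le> p" "p \<le> q" "q \<le> t + k" "\<And>s. p \<le> s \<Longrightarrow> s \<le> q \<Longrightarrow> U s \<le> ?L + \<delta>" for p q
        using deriv_le_imp_growth_le[of p q v v' "- \<sigma>"] that v_deriv v'_le tx by auto
      have U_slow: "U q \<le> U p + 3/2 * (q - p)"
        if "t \<le> p" "p \<le> q" "q \<le> t + k" "\<And>s. t \<le> s \<Longrightarrow> s \<le> q \<Longrightarrow> U s \<le> ?L + \<delta>" for p q
      proof (rule deriv_le_imp_growth_le)
        fix x assume x: "p < x" "x < q"
        have "0 < \<sigma> * (x - t)" using x that \<sigma> by simp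
        then have "v x < 1" using v_dec[of t x] that x t(3) by auto
        then have "0 < \<psi>1 (v x)" using stay(1)[of x] x that by (intro \<psi>1_pos) auto
        moreover have "v' x \<le> 0" using v'_le[of x] \<sigma> x that by auto
        moreover have "0 < x" using x that tx by linarith
        ultimately have "x * \<psi>1 (v x) * v' x \<le> 0"
          by (intro mult_nonneg_nonpos) auto
        then show "1 + \<psi> (v x) / 2 + x * \<psi>1 (v x) * v' x / 2 \<le> 3/2"
          using \<psi>_bounds[of "v x"] by linarith
      qed (use that U_deriv tx in auto)
      \<comment> \<open>A continuation argument: up to the first time at the top of the strip the
        slow growth bound holds, so that time cannot occur within the window.\<close>
      have U_below: "U s \<le> ?L + \<delta>" if s: "t \<le> s" "s \<le> t + k" for s
      proof (rule ccontr)
        assume "\<not> ?thesis"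
        then obtain r where r: "t \<le> r" "r \<le> s" "U r = ?L + \<delta>"
            "\<And>x. t \<le> x \<Longrightarrow> x < r \<Longrightarrow> U x < ?L + \<delta>"
          using first_hit[of t s U "?L + \<delta>"] U_cont[OF tx(1)] s t(2) \<delta>_pos by auto
        have "U x \<le> ?L + \<delta>" if "t \<le> x" "x \<le> r" for x
          using r(3) r(4)[of x] that by (cases "x = r") auto
        then have "U r \<le> U t + 3/2 * (r - t)"
          using U_slow[of t r] r s by auto
        then show False using r s k t(2) by auto
      qed
      \<comment> \<open>In the middle third \<open>v\<close> keeps a fixed distance from \<open>-1\<close> and \<open>1\<close>, so \<open>\<psi>1 (v x) \<ge> \<mu>\<close> there
        and the drop of \<open>U\<close> outweighs its growth on the first third.\<close>
      define p where "p = t + k / 3"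
      define q where "q = t + 2 * k / 3"
      have pq: "t \<le> p" "p \<le> q" "q \<le> t + k" "q - p = k / 3" using k by (auto simp: p_def q_def)
      have "U q \<le> U p + (3/2 - 7/2) * (q - p)"
      proof (rule deriv_le_imp_growth_le)
        fix x assume x: "p < x" "x < q"
        have "v x \<le> v t - \<sigma> * (x - t)" "v (t + k) \<le> v x - \<sigma> * (t + k - x)"
          using v_dec[of t x] v_dec[of x "t + k"] U_below x pq by auto
        moreover have "\<sigma> * (k / 3) \<le> \<sigma> * (x - t)" "\<sigma> * (k / 3) \<le> \<sigma> * (t + k - x)"
          using x \<sigma> by (auto simp: p_def q_def intro!: mult_left_mono)
        ultimately have "v x \<in> ?I" using t(3) stay(1)[of "t + k"] k by auto
        then have "\<mu> \<le> \<psi>1 (v x)" by (rule \<mu>)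
        then have "0 \<le> \<psi>1 (v x)" using \<mu> by linarith
        have "\<sigma> \<le> - v' x" using v'_le[of x] U_below x pq by auto
        with \<open>\<mu> \<le> \<psi>1 (v x)\<close> have "\<mu> * \<sigma> \<le> \<psi>1 (v x) * (- v' x)"
          by (rule mult_mono) (use \<sigma> \<open>0 \<le> \<psi>1 (v x)\<close> in linarith)+
        then have "t * (\<mu> * \<sigma>) \<le> x * (\<psi>1 (v x) * (- v' x))"
          by (rule mult_mono[rotated]) (use x pq tx \<mu> \<sigma> in auto)
        moreover have "7 \<le> t * (\<mu> * \<sigma>)" using tx(3) \<mu> \<sigma> by (simp add: field_simps)
        ultimately have "7 \<le> - (x * \<psi>1 (v x) * v' x)" by (simp add: algebra_simps)
        then show "1 + \<psi> (v x) / 2 + x * \<psi>1 (v x) * v' x / 2 \<le> 3/2 - 7/2"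
          using \<psi>_bounds[of "v x"] by linarith
      qed (use pq U_deriv tx in auto)
      moreover have "U p \<le> U t + 3/2 * (p - t)" using U_slow[of t p] U_below pq by auto
      ultimately have "U q < ?L" using t(2) pq k by (simp add: p_def)
      then show False using stay(2)[of q] pq by auto
    qed
  qed
qed


section \<open>Motion in the regions \<open>v \<le> -1\<close> and \<open>v \<ge> 1\<close>, where
  \<open>\<psi>\<close> is constant\<close>

lemma v'_low: "v x \<le> -1 \<Longrightarrow> v' x = - a * v x - sin (pi * x / 2) / \<epsilon>"
  and v'_high: "1 \<le> v x \<Longrightarrow> v' x = - a * v x - sin (3 * pi * x / 2) / \<epsilon>"
  by (simp_all add: v'_def U_low U_high mult.commute mult.left_commute)

lemma v'_le_bound:
  assumes "-1 \<le> v x"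
  shows "v' x \<le> a + 1 / \<epsilon>"
proof -
  have "- a * v x \<le> a" using assms a_pos mult_left_mono[of "-1" "v x" a] by auto
  moreover have "- (sin (pi * U x) / \<epsilon>) \<le> 1 / \<epsilon>"
    using eps_pos sin_ge_minus_one[of "pi * U x"] by (simp add: field_simps)
  ultimately show ?thesis by (simp add: v'_def)
qed

text \<open>Outside \<open>|v| < 1\<close>, adding a bounded primitive of the forcing term turns the equation into
  \<open>G' = - a v\<close>, which has a definite sign.\<close>

lemma decrease_high:
  assumes "x0 < p" "p \<le> q" "\<And>x. p \<le> x \<Longrightarrow> x \<le> q \<Longrightarrow> 1 \<le> v x"
  shows "v q - 2 / (3 * pi * \<epsilon>) * cos (3 * pi * q / 2)
    \<le> v p - 2 / (3 * pi * \<epsilon>) * cos (3 * pi * p / 2) - a * (q - p)"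
proof -
  have "v q - 2 / (3 * pi * \<epsilon>) * cos (3 * pi * q / 2)
    \<le> v p - 2 / (3 * pi * \<epsilon>) * cos (3 * pi * p / 2) + (- a) * (q - p)"
  proof (rule deriv_le_imp_growth_le[OF assms(2)])
    fix x assume x: "p \<le> x" "x \<le> q"
    show "((\<lambda>x. v x - 2 / (3 * pi * \<epsilon>) * cos (3 * pi * x / 2)) has_real_derivative - a * v x) (at x)"
      using v_deriv[of x] v'_high[of x] assms(1) assms(3)[of x] x eps_pos
      by (auto intro!: derivative_eq_intros simp: field_simps)
  next
    fix x assume "p < x" "x < q"
    then show "- a * v x \<le> - a" using assms(3)[of x] a_pos by auto
  qed
  then show ?thesis by simp
qed

lemma increase_low:
  assumes "x0 < p" "p \<le> q" "\<And>x. p \<le> x \<Longrightarrow> x \<le> q \<Longrightarrow> v x \<le> -1"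
  shows "v p - 2 / (pi * \<epsilon>) * cos (pi * p / 2) + a * (q - p)
    \<le> v q - 2 / (pi * \<epsilon>) * cos (pi * q / 2)"
proof (rule deriv_ge_imp_growth_ge[OF assms(2)])
  fix x assume x: "p \<le> x" "x \<le> q"
  show "((\<lambda>x. v x - 2 / (pi * \<epsilon>) * cos (pi * x / 2)) has_real_derivative - a * v x) (at x)"
    using v_deriv[of x] v'_low[of x] assms(1) assms(3)[of x] x eps_pos
    by (auto intro!: derivative_eq_intros simp: field_simps)
next
  fix x assume "p < x" "x < q"
  then show "a \<le> - a * v x" using assms(3)[of x] a_pos mult_left_mono[of "v x" "-1" a] by auto
qed

lemma not_stay_high:
  assumes "x0 < X"
  shows "\<exists>x\<ge>X. v x < 1"
proof (rule ccontr)
  assume "\<not> ?thesis"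
  then have high: "1 \<le> v x" if "X \<le> x" for x using that by force
  let ?c = "2 / (3 * pi * \<epsilon>)"
  have c: "0 < ?c" using eps_pos by simp
  \<comment> \<open>By this time damping has removed \<open>\<bar>v X\<bar>\<close> plus the full
    oscillation \<open>2 * ?c\<close> of the primitive, which forces
    \<open>v q \<le> 0\<close>.\<close>
  define q where "q = X + (\<bar>v X\<bar> + 2 * ?c) / a"
  have "0 \<le> (\<bar>v X\<bar> + 2 * ?c) / a" using c a_pos by (intro divide_nonneg_pos add_nonneg_nonneg) auto
  then have "X \<le> q" by (simp add: q_def)
  have "v q - ?c * cos (3 * pi * q / 2) \<le> v X - ?c * cos (3 * pi * X / 2) - a * (q - X)"
    using decrease_high[OF assms \<open>X \<le> q\<close>] high by auto
  moreover have "a * (q - X) = \<bar>v X\<bar> + 2 * ?c" using a_pos by (simp add: q_def)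
  moreover have "?c * cos (3 * pi * q / 2) \<le> ?c * 1" "?c * (-1) \<le> ?c * cos (3 * pi * X / 2)"
    using c by (intro mult_left_mono; simp)+
  ultimately show False using high[OF \<open>X \<le> q\<close>] by linarith
qed

lemma not_stay_low:
  assumes "x0 < X"
  shows "\<exists>x\<ge>X. -1 < v x"
proof (rule ccontr)
  assume "\<not> ?thesis"
  then have low: "v x \<le> -1" if "X \<le> x" for x using that by force
  let ?c = "2 / (pi * \<epsilon>)"
  have c: "0 < ?c" using eps_pos by simp
  define q where "q = X + (\<bar>v X\<bar> + 2 * ?c) / a"
  have "0 \<le> (\<bar>v X\<bar> + 2 * ?c) / a" using c a_pos by (intro divide_nonneg_pos add_nonneg_nonneg) auto
  then have "X \<le> q" by (simp add: q_def)
  have "v X - ?c * cos (pi * X / 2) + a * (q - X) \<le> v q - ?c * cos (pi * q / 2)"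
    using increase_low[OF assms \<open>X \<le> q\<close>] low by auto
  moreover have "a * (q - X) = \<bar>v X\<bar> + 2 * ?c" using a_pos by (simp add: q_def)
  moreover have "?c * (-1) \<le> ?c * cos (pi * q / 2)" "?c * cos (pi * X / 2) \<le> ?c * 1"
    using c by (intro mult_left_mono; simp)+
  ultimately show False using low[OF \<open>X \<le> q\<close>] by linarith
qed

section \<open>Every trajectory reaches the bottom\<close>

text \<open>Consider the last passage of \<open>U\<close> through the level
  \<open>2 * n + \<phi>\<close>. If \<open>v \<le> 1\<close> there, \<open>drop\<close> would force
  \<open>v \<le> -1\<close> or a later return below the level. So \<open>v > 1\<close>, hence
  \<open>U t = 3 * t / 2\<close>, which fixes the passage time.\<close>

lemma high_at_level:
  assumes "x0 < X" and above: "\<And>x. X \<le> x \<Longrightarrow> -1 < v x" and \<phi>: "a * \<epsilon> < sin (pi * \<phi>)"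
  shows "\<exists>N. \<forall>n\<ge>N. 1 < v (2 * (2 * of_int n + \<phi>) / 3)"
proof -
  obtain T where T: "x0 < T" "\<And>t n. T \<le> t \<Longrightarrow> U t = 2 * of_int n + \<phi> \<Longrightarrow> v t \<le> 1 \<Longrightarrow>
      \<exists>s\<in>{t..t+1}. v s \<le> -1 \<or> U s < 2 * of_int n + \<phi>"
    using drop[OF \<phi>, of 1] by auto
  define N where "N = \<lceil>(2 * \<bar>X\<bar> + 2 * \<bar>T\<bar> + \<bar>\<phi>\<bar>)\<rceil>"
  have "1 < v (2 * (2 * of_int n + \<phi>) / 3)" if "N \<le> n" for n
  proof -
    let ?L = "2 * of_int n + \<phi>"
    have "2 * \<bar>X\<bar> + 2 * \<bar>T\<bar> + \<bar>\<phi>\<bar> \<le> of_int n"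
      using that by (simp add: N_def ceiling_le_iff)
    then have L: "2 * X \<le> ?L" "2 * T \<le> ?L" "0 \<le> ?L" by linarith+
    have X: "0 \<le> X" using assms(1) x0_nonneg by simp
    \<comment> \<open>Beyond \<open>Q\<close> the bound \<open>U s \<ge> s / 2\<close> already keeps
      \<open>U\<close> at or above the level, so the last passage lies before
      \<open>Q\<close>.\<close>
    define Q where "Q = 2 * ?L"
    have Q: "X \<le> Q" using L X by (simp add: Q_def)
    have "U X \<le> ?L" using U_le[OF X] L by simp
    moreover have U_beyond: "?L \<le> U s" if "Q \<le> s" for s
      using U_ge[of s] that L by (simp add: Q_def)
    ultimately obtain t where t: "X \<le> t" "t \<le> Q" "U t = ?L" "\<And>s. t < s \<Longrightarrow> s \<le> Q \<Longrightarrow> ?L < U s"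
      using last_hit[of X Q U ?L] U_cont[OF assms(1)] Q by auto
    have U_after: "?L \<le> U s" if "t \<le> s" for s
      using t(3) t(4)[of s] U_beyond[of s] that by (cases "t = s"; cases "s \<le> Q"; force)
    have "?L \<le> 3 * t / 2" using U_le[of t] t X by simp
    then have "T \<le> t" using L by linarith
    have "1 < v t"
    proof (rule ccontr)
      assume "\<not> 1 < v t"
      then obtain s where "t \<le> s" "v s \<le> -1 \<or> U s < ?L"
        using T(2)[OF \<open>T \<le> t\<close> t(3)] by auto
      then show False using above[of s] U_after[of s] t(1) by auto
    qed
    moreover from this have "t = 2 * ?L / 3" using U_high[of t] t(3) by simp
    ultimately show ?thesis by simp
  qed
  then show ?thesis by blast
qed

text \<open>Otherwise \<open>v > 1\<close> at one time \<open>Y n\<close> per period of the upper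
  field. Between such times \<open>v\<close> cannot dip below 1: the arc leading back up to
  \<open>Y (n + 1)\<close> would lose too much to damping. So \<open>v \<ge> 1\<close> forever,
  against \<open>not_stay_high\<close>.\<close>

lemma reaches_bottom:
  assumes "x0 < X"
  shows "\<exists>p\<ge>X. v p \<le> -1"
proof (rule ccontr)
  assume "\<not> ?thesis"
  then have above: "-1 < v x" if "X \<le> x" for x using that by force
  \<comment> \<open>A level late enough in the half period that an arc starting on \<open>v = 1\<close> has returned before it,
    yet with \<open>sin (\<pi> \<phi>) > a \<epsilon>\<close>.\<close>
  define \<phi> where "\<phi> = arccos (- 1 + a * \<epsilon>) / pi"
  have ae: "0 < a * \<epsilon>" using a_pos eps_pos by simp
  have cos\<phi>: "cos (pi * \<phi>) = - 1 + a * \<epsilon>"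
    using ae a_eps by (simp add: \<phi>_def)
  have "arccos 0 \<le> arccos (- 1 + a * \<epsilon>)" "arccos (- 1 + a * \<epsilon>) < arccos (- 1)"
    by (rule arccos_le_arccos arccos_less_arccos; use ae a_eps in linarith)+
  then have \<phi>: "1/2 \<le> \<phi>" "\<phi> < 1" by (simp_all add: \<phi>_def field_simps)
  have "(a * \<epsilon>)\<^sup>2 < (sin (pi * \<phi>))\<^sup>2"
  proof -
    have "(sin (pi * \<phi>))\<^sup>2 = 1 - (- 1 + a * \<epsilon>)\<^sup>2" using sin_squared_eq[of "pi * \<phi>"] cos\<phi> by simp
    also have "\<dots> = 2 * (a * \<epsilon>) - (a * \<epsilon>)\<^sup>2" by (simp add: power2_eq_square algebra_simps)
    finally show ?thesis
      using mult_strict_left_mono[OF a_eps ae] unfolding power2_eq_square by linarith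
  qed
  moreover have "0 \<le> sin (pi * \<phi>)"
    using \<phi> by (intro sin_ge_zero) auto
  ultimately have "a * \<epsilon> < sin (pi * \<phi>)" by (rule power2_less_imp_less)
  from high_at_level[OF assms above this] obtain N
    where N: "\<And>n. N \<le> n \<Longrightarrow> 1 < v (2 * (2 * of_int n + \<phi>) / 3)" by blast
  define Y where "Y n = 2 * (2 * of_int n + \<phi>) / 3" for n :: int
  define m where "m = max N \<lceil>X\<rceil>"
  have X: "0 \<le> X" "X \<le> of_int m" using assms x0_nonneg by (auto simp: m_def le_max_iff_disj ceiling_le_iff[symmetric])
  have XY: "X \<le> Y n" if "m \<le> n" for n
  proof -
    have "X \<le> of_int n" using X(2) that by (simp add: order_trans[OF X(2)])
    then show ?thesis using X(1) \<phi> by (simp add: Y_def)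
  qed
  have vY: "1 < v (Y n)" if "m \<le> n" for n using N[of n] that by (simp add: Y_def m_def)
  have high: "1 \<le> v x" if n: "m \<le> n" and x: "Y n \<le> x" "x \<le> Y (n + 1)" for n x
  proof (rule ccontr)
    assume "\<not> 1 \<le> v x"
    moreover have "continuous_on {x..Y (n+1)} v" using v_cont XY[OF n] x assms by auto
    moreover have Y1: "1 < v (Y (n + 1))" using vY[of "n + 1"] n by simp
    ultimately obtain t where t: "x \<le> t" "t \<le> Y (n+1)" "v t = 1"
        "\<And>s. t < s \<Longrightarrow> s \<le> Y (n+1) \<Longrightarrow> 1 < v s"
      using last_hit[of x "Y (n+1)" v 1] x by auto
    have tY: "t < Y (n+1)" using t(2,3) Y1 by (cases "t = Y (n+1)") auto
    have tx: "x0 < t" using t(1) x XY[OF n] assms by linarith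
    have "0 \<le> v' t"
      using deriv_nonneg_if_above_right[OF v_deriv[OF tx] tY] t(3,4) by simp
    then have "sin (3 * pi * t / 2) / \<epsilon> \<le> - a" using v'_high[of t] t(3) by simp
    then have "sin (3 * pi * t / 2) / \<epsilon> < 0" using a_pos by linarith
    then have sin_neg: "sin (3 * pi * t / 2) < 0" using eps_pos by (simp add: divide_less_0_iff)
    define z where "z = 3 * t / 2 - 2 * of_int (n + 1)"
    have zlt: "z \<le> \<phi>" using tY by (simp add: z_def Y_def)
    have "3 * pi * t / 2 = pi * (2 * of_int (n + 1) + z)" by (simp add: z_def)
    then have "sin (pi * z) < 0" using sin_neg by (simp only: sin_pi_add_even)
    then have "\<not> (0 \<le> z \<and> z \<le> 1)" using sin_ge_zero[of "pi * z"] by auto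
    \<comment> \<open>The sine is nonnegative for phases in \<open>[0, 1]\<close> and
      \<open>z \<le> \<phi> < 1\<close>, so \<open>t\<close> precedes this half period and lies at
      least \<open>2 * \<phi> / 3 \<ge> 1/3\<close> before \<open>Y (n+1)\<close>.\<close>
    then have "z < 0" using zlt \<phi> by auto
    then have "3 * t < 4 * of_int (n + 1)" by (simp add: z_def)
    moreover have "Y (n + 1) = 4 * of_int (n + 1) / 3 + 2 * \<phi> / 3" by (simp add: Y_def field_simps)
    ultimately have gap: "1/3 \<le> Y (n+1) - t" using \<phi> by linarith
    \<comment> \<open>The forcing can raise \<open>v\<close> by at most
      \<open>c * (a * \<epsilon>) = 2 * a / (3 * pi)\<close>, which is less than the damping loss
      \<open>a / 3\<close>; so \<open>v\<close> could not exceed 1 at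
      \<open>Y (n+1)\<close>.\<close>
    define c where "c = 2 / (3 * pi * \<epsilon>)"
    have c: "0 \<le> c" using eps_pos by (simp add: c_def)
    have "1 \<le> v s" if "t \<le> s" "s \<le> Y (n+1)" for s
      using t(3) t(4)[of s] that by (cases "s = t") auto
    then have "v (Y (n+1)) - c * cos (3 * pi * Y (n+1) / 2)
        \<le> v t - c * cos (3 * pi * t / 2) - a * (Y (n+1) - t)"
      using decrease_high[OF tx] t(2) unfolding c_def by blast
    moreover have "3 * pi * Y (n+1) / 2 = pi * (2 * of_int (n + 1) + \<phi>)" by (simp add: Y_def)
    then have "cos (3 * pi * Y (n+1) / 2) = - 1 + a * \<epsilon>" by (simp only: cos_pi_add_even cos\<phi>)
    then have "c * cos (3 * pi * Y (n+1) / 2) = c * (a * \<epsilon>) - c" by (simp only: distrib_left)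
    moreover have "c * (a * \<epsilon>) = a * (2 / (3 * pi))" using eps_pos by (simp add: c_def)
    moreover have "a * (2 / (3 * pi)) \<le> a * (1/3)"
      using a_pos pi_gt3 by (intro mult_left_mono) (auto simp: field_simps)
    moreover have "c * (-1) \<le> c * cos (3 * pi * t / 2)" using c by (intro mult_left_mono) auto
    moreover have "a * (1/3) \<le> a * (Y (n+1) - t)" using gap a_pos by (intro mult_left_mono) auto
    ultimately show False using t(3) Y1 by linarith
  qed
  have "1 \<le> v x" if "Y m \<le> x" for x
  proof -
    define n where "n = \<lfloor>(3 * x / 2 - \<phi>) / 2\<rfloor>"
    have n: "of_int n \<le> (3 * x / 2 - \<phi>) / 2" "(3 * x / 2 - \<phi>) / 2 < of_int n + 1"
      unfolding n_def by linarith+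
    have "Y n \<le> x" "x \<le> Y (n + 1)" using n by (simp_all add: Y_def field_simps)
    moreover have "of_int m \<le> (3 * x / 2 - \<phi>) / 2" using that by (simp add: Y_def field_simps)
    then have "m \<le> n" unfolding n_def by (simp add: le_floor_iff)
    ultimately show ?thesis using high by blast
  qed
  moreover have "x0 < Y m" using XY[of m] assms by simp
  ultimately show False using not_stay_high[of "Y m"] by force
qed

section \<open>Late behaviour near \<open>v = -1\<close>\<close>

text \<open>An excursion above -1 starting at \<open>r\<close> has \<open>U r = r / 2\<close>, less
  than 3 below the next level \<open>2 * n + 1/2\<close>. Up to that level \<open>v\<close> stays
  small, since a larger \<open>v\<close> would lift \<open>U\<close> past it. After the last passage
  the barrier leaves at most time \<open>h\<close>, in which \<open>v\<close> gains at most
  \<open>k / 2\<close>.\<close>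

lemma near_bottom:
  assumes "0 < \<kappa>"
  shows "\<exists>T>x0. \<forall>p\<ge>T. v p \<le> -1 \<longrightarrow> (\<forall>x\<ge>p. v x \<le> -1 + \<kappa>)"
proof -
  define k where "k = min \<kappa> 1"
  have k: "0 < k" "k \<le> 1" "k \<le> \<kappa>" using assms by (auto simp: k_def)
  define M where "M = a + 1 / \<epsilon>"
  have M: "0 < M" using a_pos eps_pos by (simp add: M_def add_pos_pos)
  define h where "h = k / (2 * M)"
  have h: "0 < h" "M * h = k / 2" using M k by (simp_all add: h_def)
  have half: "a * \<epsilon> < sin (pi * (1/2))" using a_eps by simp
  obtain T1 where T1: "x0 < T1" "\<And>t n. T1 \<le> t \<Longrightarrow> U t = 2 * of_int n + 1/2 \<Longrightarrow> v t \<le> 1 \<Longrightarrow>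
      \<exists>s\<in>{t..t+h}. v s \<le> -1 \<or> U s < 2 * of_int n + 1/2"
    using drop[OF half h(1)] by blast
  define \<rho> where "\<rho> = \<psi> (-1 + k/2) + 1"
  have \<rho>: "0 < \<rho>" using \<psi>_strict_mono[of "-1" "-1 + k/2"] k \<psi>_low[of "-1"] by (simp add: \<rho>_def)
  \<comment> \<open>From \<open>6 / \<rho>\<close> on, \<open>v > -1 + k/2\<close> puts
    \<open>U t\<close> at least 3 above \<open>t / 2\<close>, hence above the level.\<close>
  define T where "T = max T1 (6 / \<rho>)"
  have "v x \<le> -1 + \<kappa>" if p: "T \<le> p" "v p \<le> -1" "p \<le> x" for p x
  proof (cases "v x \<le> -1")
    case False
    have px: "x0 < p" "T1 \<le> p" "0 < p" "6 / \<rho> \<le> p" using p T1(1) x0_nonneg by (auto simp: T_def)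
    obtain r where r: "p \<le> r" "r \<le> x" "v r = -1" "\<And>s. r < s \<Longrightarrow> s \<le> x \<Longrightarrow> -1 < v s"
      by (rule last_hit[OF v_cont[OF px(1)] p(3) p(2)]) (use False in auto)
    \<comment> \<open>Rounding up gives \<open>2 * n\<close> between \<open>r / 2\<close> and
      \<open>r / 2 + 2\<close>, so the level lies ahead of \<open>U r\<close> but by less than
      3.\<close>
    define n where "n = \<lceil>r / 4\<rceil>"
    have n: "r / 4 \<le> of_int n" "of_int n < r / 4 + 1" unfolding n_def by linarith+
    let ?L = "2 * of_int n + 1/2"
    have L: "r / 2 < ?L" "?L < r / 2 + 3" using n by auto
    have below_level: "v t \<le> -1 + k/2" if t: "r \<le> t" "U t \<le> ?L" for t
    proof (rule ccontr)
      assume "\<not> ?thesis"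
      then have "\<rho> - 1 \<le> \<psi> (v t)" using \<psi>_mono[of "-1 + k/2" "v t"] by (simp add: \<rho>_def)
      then have "t * (1 + (\<rho> - 1) / 2) \<le> U t"
        unfolding U_def using t r px by (intro mult_left_mono) auto
      then have "t / 2 + t * \<rho> / 2 \<le> U t" by (simp add: algebra_simps add_divide_distrib diff_divide_distrib)
      moreover have "6 \<le> p * \<rho>" using px(4) \<rho> by (simp add: field_simps)
      moreover have "p * \<rho> \<le> t * \<rho>" using t r \<rho> by (intro mult_right_mono) auto
      ultimately show False using t L by linarith
    qed
    show ?thesis
    proof (cases "U x \<le> ?L")
      case True
      then show ?thesis using below_level[of x] r k by auto
    next
      case False
      have rx: "x0 < r" using r px by linarith
      have "U r < ?L" using U_low[of r] r(3) L by simp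
      then obtain t where t: "r \<le> t" "t \<le> x" "U t = ?L" "\<And>s. t < s \<Longrightarrow> s \<le> x \<Longrightarrow> ?L < U s"
        using last_hit[OF U_cont[OF rx] r(2), of ?L] False by auto
      have rt: "r < t" using t(1,3) \<open>U r < ?L\<close> by (cases "r = t") auto
      have vt: "v t \<le> -1 + k/2" using below_level[of t] t by simp
      have "x \<le> t + h"
      proof (rule ccontr)
        assume "\<not> ?thesis"
        moreover obtain s where "t \<le> s" "s \<le> t + h" "v s \<le> -1 \<or> U s < ?L"
          using T1(2)[of t n] t r px vt k by auto
        ultimately show False using r(4)[of s] rt t(3) t(4)[of s] by (cases "s = t") auto
      qed
      have "v x \<le> v t + M * (x - t)"
      proof (rule deriv_le_imp_growth_le[OF t(2)])
        fix y assume "t < y" "y < x"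
        then show "v' y \<le> M" unfolding M_def using r(4)[of y] rt by (intro v'_le_bound) auto
      qed (use v_deriv rx rt in auto)
      moreover have "M * (x - t) \<le> M * h" using \<open>x \<le> t + h\<close> M by (intro mult_left_mono) auto
      ultimately show ?thesis using vt h k by linarith
    qed
  qed (use assms in simp)
  moreover have "x0 < T" using T1(1) by (auto simp: T_def)
  ultimately show ?thesis by blast
qed

text \<open>The level \<open>b / 2\<close>, with \<open>b\<close> just past the fold point, is a
  barrier. After its last passage before \<open>b\<close> the phase never falls below it, so
  \<open>drop\<close> yields \<open>v s \<le> -1\<close>; then \<open>U s = s / 2\<close> gives
  \<open>s \<ge> b\<close>.\<close>

lemma exit_after_fold:
  assumes "0 < h"
  shows "\<exists>N. \<forall>n\<ge>N. \<exists>s. fold_pt a \<epsilon> n < s \<and> s \<le> fold_pt a \<epsilon> n + h \<and> v s \<le> -1"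
proof -
  \<comment> \<open>The length \<open>g\<close> is spent twice, once to reach \<open>b\<close> and
    once in \<open>drop\<close>, hence \<open>h / 2\<close>; the other bound keeps
    \<open>fold0 + g\<close> where the sine exceeds \<open>a * \<epsilon>\<close>.\<close>
  define g where "g = min (h / 2) (1 - fold0)"
  have g: "0 < g" "g \<le> h / 2" "g \<le> 1 - fold0" using assms fold0_bounds unfolding g_def by linarith+
  define \<phi> where "\<phi> = (fold0 + g) / 2"
  have "a * \<epsilon> < sin (pi * \<phi>)"
    using sin_gt[of 0 "fold0 + g"] g fold0_bounds by (simp add: fold_pt_eq \<phi>_def)
  then obtain T where T: "x0 < T" "\<And>t n. T \<le> t \<Longrightarrow> U t = 2 * of_int n + \<phi> \<Longrightarrow> v t \<le> 1 \<Longrightarrow>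
      \<exists>s\<in>{t..t+g}. v s \<le> -1 \<or> U s < 2 * of_int n + \<phi>"
    using drop[of \<phi> g] g by blast
  \<comment> \<open>The choice 2 gives \<open>v \<le> 1\<close>, as \<open>drop\<close>
    requires.\<close>
  obtain T2 where T2: "x0 < T2" "\<And>p x. T2 \<le> p \<Longrightarrow> v p \<le> -1 \<Longrightarrow> p \<le> x \<Longrightarrow> v x \<le> 1"
    using near_bottom[of 2] by auto
  obtain p where p: "max T T2 \<le> p" "v p \<le> -1" using reaches_bottom[of "max T T2"] T(1)
    by (meson less_le_trans max.cobounded1)
  have px: "x0 < p" "0 < p" "T \<le> p" "T2 \<le> p" using p T(1) x0_nonneg by auto
  show ?thesis
  proof (rule exI[of _ "\<lceil>p\<rceil>"], intro allI impI)
    fix n assume "\<lceil>p\<rceil> \<le> n"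
    then have "p \<le> of_int n" by (simp add: ceiling_le_iff)
    then have pn: "p \<le> fold_pt a \<epsilon> n" using px fold0_bounds by (simp add: fold_pt_eq)
    define b where "b = fold_pt a \<epsilon> n + g"
    let ?L = "2 * of_int n + \<phi>"
    have L: "?L = b / 2" by (simp add: b_def \<phi>_def fold_pt_eq add_divide_distrib)
    have Up: "U p \<le> ?L" using U_low[OF p(2)] pn g L by (simp add: b_def)
    have Ub: "?L \<le> U b" using U_ge[of b] pn px g L by (simp add: b_def)
    have pb: "p \<le> b" using pn g by (simp add: b_def)
    obtain t where t: "p \<le> t" "t \<le> b" "U t = ?L" "\<And>s. t < s \<Longrightarrow> s \<le> b \<Longrightarrow> ?L < U s"
      by (rule last_hit[OF U_cont[OF px(1)] pb Up Ub]) blast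
    have "v t \<le> 1" using T2(2)[OF px(4) p(2) t(1)] .
    then obtain s where s: "t \<le> s" "s \<le> t + g" "v s \<le> -1 \<or> U s < ?L"
      using T(2)[OF _ t(3)] t px by auto
    have "?L \<le> U s"
    proof (cases "s \<le> b")
      case True then show ?thesis using t(3) t(4)[of s] s by (cases "s = t") auto
    next
      case False then show ?thesis using U_ge[of s] L t s px by auto
    qed
    then have "v s \<le> -1" using s by auto
    moreover have "b \<le> s" using U_low[OF \<open>v s \<le> -1\<close>] \<open>?L \<le> U s\<close> L by simp
    ultimately show "\<exists>s. fold_pt a \<epsilon> n < s \<and> s \<le> fold_pt a \<epsilon> n + h \<and> v s \<le> -1"
      using s t g by (intro exI[of _ s]) (auto simp: b_def)
  qed
qed

section \<open>Comparison with \<open>v_r\<close> on one period\<close>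

lemma sin_ge_if_leaves_down:
  assumes "x0 < r" "v r = -1" "r < x" "\<And>s. r < s \<Longrightarrow> s \<le> x \<Longrightarrow> v s < -1"
  shows "a * \<epsilon> \<le> sin (pi * r / 2)"
proof -
  have "0 \<le> - v' r"
    using deriv_nonneg_if_above_right[OF DERIV_minus[OF v_deriv[OF assms(1)]] assms(3)] assms(2,4) by simp
  then have "a \<le> sin (pi * r / 2) / \<epsilon>" using v'_low[of r] assms(2) by simp
  then show ?thesis using eps_pos by (simp add: pos_le_divide_eq)
qed

lemma sin_le_if_leaves_up:
  assumes "x0 < r" "v r = -1" "r < x" "\<And>s. r < s \<Longrightarrow> s \<le> x \<Longrightarrow> -1 < v s"
  shows "sin (pi * r / 2) \<le> a * \<epsilon>"
proof -
  have "0 \<le> v' r"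
    using deriv_nonneg_if_above_right[OF v_deriv[OF assms(1)] assms(3)] assms(2,4) by simp
  then have "sin (pi * r / 2) / \<epsilon> \<le> a" using v'_low[of r] assms(2) by simp
  then show ?thesis using eps_pos by (simp add: pos_divide_le_eq)
qed

lemma last_hit_down:
  assumes "x0 < p" "p \<le> x" "-1 \<le> v p" "v x < -1"
  obtains r where "p \<le> r" "r < x" "v r = -1" "\<And>s. r < s \<Longrightarrow> s \<le> x \<Longrightarrow> v s < -1"
proof -
  have "- v p \<le> 1" "1 \<le> - v x" using assms(3,4) by auto
  then obtain r where r: "p \<le> r" "r \<le> x" "- v r = 1" "\<And>s. r < s \<Longrightarrow> s \<le> x \<Longrightarrow> 1 < - v s"
    by (rule last_hit[OF continuous_on_minus[OF v_cont[OF assms(1)]] assms(2)]) blast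
  show thesis
  proof (rule that)
    show "r < x" using r assms(4) by (cases "r = x") auto
  qed (use r in force)+
qed

text \<open>If \<open>v\<close> were below -1 at the fold point, its last descent through -1 would
  occur at some \<open>r\<close> whose sine is at least that at the fold point. The forcing
  primitive then does not lower \<open>v\<close> in between, and damping raises it strictly: a
  contradiction.\<close>

lemma above_at_fold:
  assumes "x0 < p" "-1 \<le> v p" "p \<le> fold_pt a \<epsilon> n"
  shows "-1 \<le> v (fold_pt a \<epsilon> n)"
proof (rule ccontr)
  let ?F = "fold_pt a \<epsilon> n"
  assume "\<not> ?thesis"
  then have "v ?F < -1" by simp
  then obtain r where r: "p \<le> r" "r < ?F" "v r = -1" "\<And>s. r < s \<Longrightarrow> s \<le> ?F \<Longrightarrow> v s < -1"
    by (rule last_hit_down[OF assms(1,3,2)]) blast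
  have rx: "x0 < r" using r assms by linarith
  have ge: "a * \<epsilon> \<le> sin (pi * r / 2)" using sin_ge_if_leaves_down[OF rx r(3,2)] r(4) by blast
  have ae: "0 \<le> a * \<epsilon>" using a_pos eps_pos by simp
  have "(cos (pi * r / 2))\<^sup>2 \<le> (cos (pi * ?F / 2))\<^sup>2"
    using power_mono[OF ge ae, of 2] by (simp add: cos_squared_eq sin_fold)
  moreover have "0 \<le> cos (pi * ?F / 2)"
  proof -
    have "pi * ?F / 2 = pi * (2 * of_int n + fold0 / 2)" by (simp add: fold_pt_eq field_simps)
    then have "cos (pi * ?F / 2) = cos (pi * (fold0 / 2))" by (simp only: cos_pi_add_even)
    moreover have "pi * (fold0 / 2) \<le> pi * (1/2)" using fold0_bounds by (intro mult_left_mono) auto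
    moreover have "0 \<le> pi * (fold0 / 2)" using fold0_bounds by simp
    ultimately have "0 \<le> cos (pi * (fold0 / 2))" by (intro cos_ge_zero) linarith+
    then show ?thesis using \<open>cos (pi * ?F / 2) = cos (pi * (fold0 / 2))\<close> by simp
  qed
  ultimately have "cos (pi * r / 2) \<le> cos (pi * ?F / 2)" by (rule power2_le_imp_le)
  then have "2 / (pi * \<epsilon>) * cos (pi * r / 2) \<le> 2 / (pi * \<epsilon>) * cos (pi * ?F / 2)"
    using eps_pos by (intro mult_left_mono) auto
  moreover have "v s \<le> -1" if "r \<le> s" "s \<le> ?F" for s
    using r(3) r(4)[of s] that by (cases "s = r") auto
  then have "v r - 2 / (pi * \<epsilon>) * cos (pi * r / 2) + a * (?F - r)
    \<le> v ?F - 2 / (pi * \<epsilon>) * cos (pi * ?F / 2)"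
    using increase_low[OF rx] r(2) by auto
  moreover have "0 < a * (?F - r)" using a_pos r(2) by simp
  moreover have "v ?F < -1" using r(2,4) by auto
  ultimately show False using r(3) by linarith
qed

text \<open>While \<open>v \<le> -1\<close> both \<open>v\<close> and the comparison function solve the same linear equation, so their
  difference decays like \<open>exp (- a x)\<close>.\<close>

lemma low_difference:
  assumes "x0 < p" "p \<le> q" "\<And>x. p \<le> x \<Longrightarrow> x \<le> q \<Longrightarrow> v x \<le> -1"
  shows "v q - v_minus a \<epsilon> c q = (v p - v_minus a \<epsilon> c p) * exp (- a * (q - p))"
proof -
  let ?d = "\<lambda>x. (v x - v_minus a \<epsilon> c x) * exp (a * x)"
  have d': "(?d has_real_derivative 0) (at x)" if "p \<le> x" "x \<le> q" for x
  proof -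
    have dv: "(v has_real_derivative - a * v x - sin (pi * x / 2) / \<epsilon>) (at x)"
      using v_deriv[of x] v'_low[of x] assms that by auto
    show ?thesis
      by (rule derivative_eq_intros dv v_minus_deriv refl)+ (simp add: algebra_simps)
  qed
  have "?d q = ?d p"
    using deriv_le_imp_growth_le[OF assms(2), of ?d "\<lambda>_. 0" 0]
      deriv_ge_imp_growth_ge[OF assms(2), of ?d "\<lambda>_. 0" 0] d' by simp
  moreover have "v q - v_minus a \<epsilon> c q = ?d q * exp (- (a * q))" by (simp add: exp_minus)
  moreover have "exp (a * p) * exp (- (a * q)) = exp (- a * (q - p))"
    by (simp add: exp_add[symmetric] algebra_simps)
  ultimately show ?thesis by (simp only: mult.assoc)
qed

text \<open>A descent below -1 can only start where the lower field does not point up, thus before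
  the return point, where \<open>v_minus\<close> is at most -1. From there the difference keeps its
  sign as long as \<open>v \<le> -1\<close>.\<close>

lemma v_r_le:
  assumes "x0 < fold_pt a \<epsilon> n" "-1 \<le> v (fold_pt a \<epsilon> n)"
    and "fold_pt a \<epsilon> n \<le> x" "x \<le> fold_pt a \<epsilon> n + 4"
  shows "(if x \<le> fold_pt a \<epsilon> n + x_ret a \<epsilon> then v_minus a \<epsilon> (fold_pt a \<epsilon> n) x else -1) \<le> v x"
proof (cases "v x < -1")
  case False
  then show ?thesis using v_minus_fold_low[of n x] assms by auto
next
  case True
  let ?F = "fold_pt a \<epsilon> n"
  obtain r where r: "?F \<le> r" "r < x" "v r = -1" "\<And>s. r < s \<Longrightarrow> s \<le> x \<Longrightarrow> v s < -1"
    by (rule last_hit_down[OF assms(1,3,2) True]) blast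
  have rx: "x0 < r" using r assms by linarith
  have "a * \<epsilon> \<le> sin (pi * r / 2)" using sin_ge_if_leaves_down[OF rx r(3,2)] r(4) by blast
  then have "r \<le> 4 * of_int n + 2 - fold0" using sin_lt[of n r] r(2) assms(4) by force
  then have "r \<le> ?F + x_ret a \<epsilon>" using x_ret_first_return(1) by (simp add: fold_pt_eq)
  then have "v_minus a \<epsilon> ?F r \<le> v r" using v_minus_fold_low[of n r] r by simp
  moreover have "v s \<le> -1" if "r \<le> s" "s \<le> x" for s
    using r(3) r(4)[of s] that by (cases "s = r") auto
  then have "v x - v_minus a \<epsilon> ?F x = (v r - v_minus a \<epsilon> ?F r) * exp (- a * (x - r))"
    by (rule low_difference[OF rx less_imp_le[OF r(2)]])
  ultimately have "v_minus a \<epsilon> ?F x \<le> v x"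
    by (metis diff_ge_0_iff_ge exp_ge_zero mult_nonneg_nonneg)
  \<comment> \<open>After the return \<open>v_minus\<close> would be at least -1, yet it lies below
    \<open>v x < -1\<close>.\<close>
  moreover have "\<not> ?F + x_ret a \<epsilon> \<le> x"
  proof
    assume "?F + x_ret a \<epsilon> \<le> x"
    from v_minus_fold_return[OF this assms(4)] calculation True show False by linarith
  qed
  ultimately show ?thesis by simp
qed

text \<open>Up to \<open>s\<close> the comparison solution has sunk by at most
  \<open>h / \<epsilon>\<close>. From \<open>s\<close> on, \<open>v\<close> follows it with at most
  that gap until \<open>v\<close> is back at -1, after which the comparison solution rises and
  \<open>v\<close> is at most \<open>-1 + \<kappa>\<close>.\<close>

lemma le_v_r:
  assumes F: "x0 < fold_pt a \<epsilon> n"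
    and s: "fold_pt a \<epsilon> n < s" "s \<le> fold_pt a \<epsilon> n + h" "v s \<le> -1"
    and h: "h \<le> 2 - 2 * fold0"
    and \<kappa>: "0 \<le> \<kappa>" "\<And>x. fold_pt a \<epsilon> n \<le> x \<Longrightarrow> v x \<le> -1 + \<kappa>"
    and x: "fold_pt a \<epsilon> n \<le> x" "x \<le> fold_pt a \<epsilon> n + 4"
  shows "v x \<le> (if x \<le> fold_pt a \<epsilon> n + x_ret a \<epsilon> then v_minus a \<epsilon> (fold_pt a \<epsilon> n) x else -1) + \<kappa> + h / \<epsilon>"
proof -
  let ?F = "fold_pt a \<epsilon> n" and ?y = "v_minus a \<epsilon> (fold_pt a \<epsilon> n)"
  define R where "R = ?F + x_ret a \<epsilon>"
  \<comment> \<open>Here the field on \<open>v = -1\<close> turns from pointing down to pointing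
    up.\<close>
  define m where "m = 4 * of_int n + 2 - fold0"
  have mR: "s \<le> m" "m \<le> R" "R \<le> ?F + 4"
    using s h x_ret_first_return(1,2) by (auto simp: R_def m_def fold_pt_eq)
  have h_nonneg: "0 \<le> h / \<epsilon>" using s eps_pos by simp
  have y_low: "?y z \<le> -1" if "?F \<le> z" "z \<le> R" for z
    using v_minus_fold_low[of n z] that by (simp add: R_def)
  have y_ge: "-1 - (z - ?F) / \<epsilon> \<le> ?y z" if "?F \<le> z" "z \<le> R" for z
  proof -
    have "?y ?F + (- 1 / \<epsilon>) * (z - ?F) \<le> ?y z"
    proof (rule deriv_ge_imp_growth_ge[OF that(1) v_minus_deriv])
      fix w assume "?F < w" "w < z"
      then have "0 \<le> - a * ?y w" using y_low[of w] that a_pos by (simp add: mult_nonneg_nonpos)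
      moreover have "sin (pi * w / 2) / \<epsilon> \<le> 1 / \<epsilon>" using eps_pos by (simp add: divide_right_mono)
      ultimately show "- 1 / \<epsilon> \<le> - a * ?y w - sin (pi * w / 2) / \<epsilon>" by simp
    qed
    then show ?thesis by (simp add: v_minus_start)
  qed
  have y_ge': "-1 - h / \<epsilon> \<le> ?y z" if "?F \<le> z" "z \<le> s" for z
  proof -
    have "(z - ?F) / \<epsilon> \<le> h / \<epsilon>" using that s eps_pos by (intro divide_right_mono) auto
    then show ?thesis using y_ge[of z] that mR by simp
  qed
  have y_mono: "?y p \<le> ?y q" if "m \<le> p" "p \<le> q" "q \<le> R" for p q
  proof -
    have "?y p + 0 * (q - p) \<le> ?y q"
    proof (rule deriv_ge_imp_growth_ge[OF that(2) v_minus_deriv])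
      fix w assume w: "p < w" "w < q"
      then have "sin (pi * w / 2) < a * \<epsilon>" using sin_lt[of n w] that mR by (simp add: m_def)
      then have "sin (pi * w / 2) / \<epsilon> < a" using eps_pos by (simp add: pos_divide_less_eq)
      moreover have "a * ?y w \<le> a * (-1)" using y_low[of w] w that mR s a_pos by (intro mult_left_mono) auto
      ultimately show "0 \<le> - a * ?y w - sin (pi * w / 2) / \<epsilon>" by simp
    qed
    then show ?thesis by simp
  qed
  have sx: "x0 < s" using F s by linarith
  have follow: "v q \<le> ?y q + h / \<epsilon>" if "s \<le> q" "\<And>z. s \<le> z \<Longrightarrow> z \<le> q \<Longrightarrow> v z \<le> -1" for q
  proof -
    have "v q - ?y q = (v s - ?y s) * exp (- a * (q - s))" using low_difference[OF sx that] by simp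
    also have "\<dots> \<le> h / \<epsilon> * exp (- a * (q - s))"
      using y_ge'[of s] s by (intro mult_right_mono) auto
    also have "\<dots> \<le> h / \<epsilon> * 1" using h_nonneg that(1) a_pos by (intro mult_left_mono) auto
    finally show ?thesis by simp
  qed
  \<comment> \<open>Before \<open>m\<close> the field on \<open>v = -1\<close> points down, so no
    upward exit is possible.\<close>
  have low_m: "v z \<le> -1" if z: "s \<le> z" "z \<le> m" for z
  proof (rule ccontr)
    assume vz: "\<not> ?thesis"
    obtain r where r: "s \<le> r" "r \<le> z" "v r = -1" "\<And>w. r < w \<Longrightarrow> w \<le> z \<Longrightarrow> -1 < v w"
      by (rule last_hit[OF v_cont[OF sx] z(1) s(3)]) (use vz in auto)
    have "r < z" using r vz by (cases "r = z") auto
    then have "sin (pi * r / 2) \<le> a * \<epsilon>" using sin_le_if_leaves_up[of r z] r sx by auto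
    then show False using sin_gt[of n r] r s z \<open>r < z\<close> by (auto simp: m_def)
  qed
  have le_y: "v x \<le> ?y x + \<kappa> + h / \<epsilon>" if "x \<le> R"
  proof (cases "x < s")
    case True
    then show ?thesis using y_ge'[of x] \<kappa>(2)[of x] x by simp
  next
    case False
    show ?thesis
    proof (cases "\<forall>z. s \<le> z \<and> z \<le> x \<longrightarrow> v z \<le> -1")
      case True
      then show ?thesis using follow[of x] False \<kappa> by auto
    next
      case not_low: False
      then obtain q where q: "s \<le> q" "q \<le> x" "-1 < v q" by force
      have mq: "m < q" using low_m[of q] q by force
      have mx: "x0 < m" using sx mR by simp
      obtain r where r: "m \<le> r" "r \<le> q" "v r = -1" "\<And>w. m \<le> w \<Longrightarrow> w < r \<Longrightarrow> v w < -1"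
        by (rule first_hit[OF v_cont[OF mx] less_imp_le[OF mq] low_m[OF mR(1) order_refl]
          less_imp_le[OF q(3)]]) blast
      have "v z \<le> -1" if "s \<le> z" "z \<le> r" for z
        using low_m[of z] r(3) r(4)[of z] that by (cases "z \<le> m"; cases "z = r") auto
      then have "v r \<le> ?y r + h / \<epsilon>" using follow[of r] r mR by auto
      moreover have "?y r \<le> ?y x" using y_mono[of r x] r q that by auto
      ultimately show ?thesis using r(3) \<kappa>(2)[of x] x by linarith
    qed
  qed
  show ?thesis
    using le_y \<kappa>(2)[OF x(1)] h_nonneg by (auto simp: R_def)
qed

lemma tendsto_v_r: "((\<lambda>x. v x - v_r a \<epsilon> x) \<longlongrightarrow> 0) at_top"
proof (rule tendstoI)
  fix e :: real assume e: "0 < e"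
  define \<kappa> where "\<kappa> = e / 4"
  \<comment> \<open>The two errors \<open>\<kappa>\<close> and \<open>h / \<epsilon>\<close> are
    each at most \<open>e / 4\<close>.\<close>
  define h where "h = min (2 - 2 * fold0) (\<epsilon> * e / 4)"
  have h: "0 < h" "h \<le> 2 - 2 * fold0" using e eps_pos fold0_bounds by (auto simp: h_def)
  have "h \<le> \<epsilon> * e / 4" unfolding h_def by (rule min.cobounded2)
  then have "h / \<epsilon> \<le> e / 4" using eps_pos by (simp add: pos_divide_le_eq mult.commute)
  have \<kappa>: "0 < \<kappa>" using e by (simp add: \<kappa>_def)
  obtain T where T: "x0 < T" "\<And>p x. T \<le> p \<Longrightarrow> v p \<le> -1 \<Longrightarrow> p \<le> x \<Longrightarrow> v x \<le> -1 + \<kappa>"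
    using near_bottom[OF \<kappa>] by blast
  obtain p where p: "T \<le> p" "v p \<le> -1" using reaches_bottom[OF T(1)] by blast
  obtain q where q: "T \<le> q" "-1 < v q" using not_stay_low[OF T(1)] by blast
  obtain N where N: "\<forall>n\<ge>N. \<exists>s. fold_pt a \<epsilon> n < s \<and> s \<le> fold_pt a \<epsilon> n + h \<and> v s \<le> -1"
    using exit_after_fold[OF h(1)] ..
  \<comment> \<open>The extra 4 is one period, so that even the fold point preceding
    \<open>x\<close> lies beyond all thresholds.\<close>
  define X where "X = max (fold_pt a \<epsilon> N) (max p q) + 4"
  have "\<bar>v x - v_r a \<epsilon> x\<bar> < e" if "X \<le> x" for x
  proof -
    define n where "n = \<lfloor>(x - fold_pt a \<epsilon> 0) / 4\<rfloor>"
    have vr: "v_r a \<epsilon> x = (if x \<le> fold_pt a \<epsilon> n + x_ret a \<epsilon>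
        then v_minus a \<epsilon> (fold_pt a \<epsilon> n) x else -1)"
      unfolding v_r_def Let_def n_def[symmetric] by (rule refl)
    have "of_int n \<le> (x - fold_pt a \<epsilon> 0) / 4" "(x - fold_pt a \<epsilon> 0) / 4 < of_int n + 1"
      unfolding n_def by linarith+
    then have x: "fold_pt a \<epsilon> n \<le> x" "x \<le> fold_pt a \<epsilon> n + 4" by (simp_all add: fold_pt_eq)
    then have big: "fold_pt a \<epsilon> N \<le> fold_pt a \<epsilon> n" "p \<le> fold_pt a \<epsilon> n" "q \<le> fold_pt a \<epsilon> n"
      using that by (auto simp: X_def)
    then have "N \<le> n" by (simp add: fold_pt_eq)
    then obtain s where s: "fold_pt a \<epsilon> n < s" "s \<le> fold_pt a \<epsilon> n + h" "v s \<le> -1" using N by blast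
    have Fx: "x0 < fold_pt a \<epsilon> n" using big p T(1) by linarith
    have "-1 \<le> v (fold_pt a \<epsilon> n)" using above_at_fold[of q n] q T(1) big by simp
    from v_r_le[OF Fx this x] have "v_r a \<epsilon> x \<le> v x" unfolding vr .
    moreover have "v z \<le> -1 + \<kappa>" if "fold_pt a \<epsilon> n \<le> z" for z
      using T(2)[OF p] big that by simp
    from le_v_r[OF Fx s h(2) less_imp_le[OF \<kappa>] this x]
    have "v x \<le> v_r a \<epsilon> x + \<kappa> + h / \<epsilon>" unfolding vr .
    ultimately show ?thesis using \<open>h / \<epsilon> \<le> e / 4\<close> e unfolding \<kappa>_def by linarith
  qed
  then show "\<forall>\<^sub>F x in at_top. dist (v x - v_r a \<epsilon> x) 0 < e"
    unfolding eventually_at_top_linorder by (auto simp: dist_real_def)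
qed

end

theorem theorem8:
  fixes \<psi> :: "real \<Rightarrow> real" and a :: real
  assumes "transition_function \<psi>" and "a > 0"
  shows "\<exists>\<epsilon>0>0. \<forall>\<epsilon>. 0 < \<epsilon> \<and> \<epsilon> < \<epsilon>0 \<longrightarrow>
           (\<forall>(v :: real \<Rightarrow> real) (x0 :: real).
              (\<forall>x\<ge>x0. (v has_real_derivative
                   ((- a * \<epsilon> * v x - sin (pi * x * (1 + \<psi> (v x) / 2))) / \<epsilon>)) (at x within {x0..}))
              \<longrightarrow> ((\<lambda>x. v x - v_r a \<epsilon> x) \<longlongrightarrow> 0) at_top)"
\<comment> \<open>The threshold \<open>1 / a\<close> expresses
  \<open>a * \<epsilon> < 1\<close>.\<close>
proof (intro exI[of _ "1 / a"] conjI allI impI)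
  show "0 < 1 / a" using assms(2) by simp
  fix \<epsilon> v x0
  assume \<epsilon>: "0 < \<epsilon> \<and> \<epsilon> < 1 / a"
    and ode: "\<forall>x\<ge>x0. (v has_real_derivative
      ((- a * \<epsilon> * v x - sin (pi * x * (1 + \<psi> (v x) / 2))) / \<epsilon>)) (at x within {x0..})"
  obtain \<psi>1 where \<psi>: "\<And>w. (\<psi> has_real_derivative \<psi>1 w) (at w)" "continuous_on UNIV \<psi>1"
      "\<And>w. \<bar>w\<bar> \<ge> 1 \<Longrightarrow> \<psi> w = sgn w" "\<And>w. \<bar>w\<bar> < 1 \<Longrightarrow> 0 < \<psi>1 w"
    using assms(1) unfolding transition_function_def by blast
  interpret regularized_trajectory a \<epsilon> \<psi> \<psi>1 v "max x0 0"
  proof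
    show "a * \<epsilon> < 1" using \<epsilon> assms(2) by (simp add: field_simps)
    fix x assume "max x0 0 < x"
    then have x: "x0 < x" by simp
    then have "(v has_real_derivative
        ((- a * \<epsilon> * v x - sin (pi * x * (1 + \<psi> (v x) / 2))) / \<epsilon>)) (at x within {x0..})"
      using ode by simp
    \<comment> \<open>Restricting to an open half-line turns the one-sided derivative into a
      two-sided one.\<close>
    then have "(v has_real_derivative
        ((- a * \<epsilon> * v x - sin (pi * x * (1 + \<psi> (v x) / 2))) / \<epsilon>)) (at x within {x0<..})"
      by (rule DERIV_subset) auto
    then have "(v has_real_derivative
        ((- a * \<epsilon> * v x - sin (pi * x * (1 + \<psi> (v x) / 2))) / \<epsilon>)) (at x)"
      using x by (simp add: at_within_open[of x "{x0<..}"])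
    moreover have "(- a * \<epsilon> * v x - sin (pi * x * (1 + \<psi> (v x) / 2))) / \<epsilon>
        = - a * v x - sin (pi * (x * (1 + \<psi> (v x) / 2))) / \<epsilon>"
      using \<epsilon> by (simp add: diff_divide_distrib mult.assoc)
    ultimately show "(v has_real_derivative
        - a * v x - sin (pi * (x * (1 + \<psi> (v x) / 2))) / \<epsilon>) (at x)"
      by (simp only:)
  qed (use \<psi> \<epsilon> assms(2) in auto)
  show "((\<lambda>x. v x - v_r a \<epsilon> x) \<longlongrightarrow> 0) at_top" by (rule tendsto_v_r)
qed

end
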